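(* Let $N_t,N_r,L\ge 1$ be integers, $N_0>0$, $P>0$, and let $\mu_1,\dots,\mu_L\ge 0$ with $\sum_{l=1}^L\mu_l=L$. Let $\mathbf{H}_1,\dots,\mathbf{H}_L$ be mutually independent random $N_r\times N_t$ complex matrices with $E[\mathrm{tr}(\mathbf{H}_l\mathbf{H}_l^H)]<\infty$. For matrices $\mathbf{F}_1,\dots,\mathbf{F}_L\in\mathbb{C}^{N_t\times N_t}$ and invertible $\mathbf{P}_1,\dots,\mathbf{P}_L\in\mathbb{C}^{N_t\times N_t}$, put $\boldsymbol{\Sigma}_l=\mathbf{P}_l\mathbf{P}_l^H$ and let the weighted sum-rate $R_{\rm sum}^{\rm w}=\sum_{l=1}^L\mu_l R_l$ be as defined in the context. Consider maximizing $R_{\rm sum}^{\rm w}$ over $(\mathbf{F}_l,\mathbf{P}_l)_{l=1}^L$ subject to $\sum_{l=1}^L\mathrm{tr}(\mathbf{P}_l\mathbf{P}_l^H)\le P$. Then an optimal design satisfies, for some real $\theta$, the following conditions: (i) for $l=1,\dots,L$: $-\mu_l\log_2 e\; E_{\mathbf{H}_l}\big[\boldsymbol{\Sigma}_{\mathbf{u}_l|\mathbf{y}_l,\mathbf{H}_l}(\mathbf{H}_l)^{-1}(\mathbf{F}_l-\mathbf{T}_l(\mathbf{H}_l))\boldsymbol{\Sigma}_{S,l}\big]=\mathbf{0}$; (ii) $\boldsymbol{\Sigma}_l=\mathbf{P}_l\mathbf{P}_l^H$ for $l=1,\dots,L$; (iii) for $t=1,\dots,L$: $$\mu_t\log_2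 e\,(\mathbf{P}_t^H)^{-1}-\log_2 e\Big[\sum_{l=1}^{t-1}\mu_l E_{\mathbf{H}_l}[\mathbf{G}_{1,l}(\mathbf{H}_l)]+\mu_t E_{\mathbf{H}_t}[\mathbf{G}_{2,t}(\mathbf{H}_t)]+\sum_{l=t+1}^{L}\mu_l E_{\mathbf{H}_l}[\mathbf{G}_{3,l}(\mathbf{H}_l)]\Big]\mathbf{P}_t=\theta\mathbf{P}_t;$$ (iv) $\theta\big(\sum_{l=1}^L\mathrm{tr}(\mathbf{P}_l\mathbf{P}_l^H)-P\big)=0$; (v) $\sum_{l=1}^L\mathrm{tr}(\mathbf{P}_l\mathbf{P}_l^H)-P\le 0$; (vi) $\theta\ge 0$. Here, writing $\mathbf{S}_l=\boldsymbol{\Sigma}_{\mathbf{u}_l|\mathbf{y}_l,\mathbf{H}_l}(\mathbf{H}_l)^{-1}$ and $\mathbf{T}_l=\mathbf{T}_l(\mathbf{H}_l)$: $\mathbf{G}_{1,l}(\mathbf{H}_l)=\mathbf{T}_l^H\mathbf{S}_l\mathbf{T}_l$; $\mathbf{G}_{2,t}(\mathbf{H}_t)=\mathbf{S}_t-\mathbf{T}_t^H\mathbf{S}_t+\mathbf{T}_t^H\mathbf{S}_t\mathbf{T}_t-\mathbf{S}_t\mathbf{T}_t$; $\mathbf{G}_{3,l}(\mathbf{H}_l)=\mathbf{F}_l^H\mathbf{S}_l\mathbf{F}_l-\mathbf{T}_l^H\mathbf{S}_l\mathbf{F}_l+\mathbf{T}_l^H\mathbf{S}_l\mathbf{T}_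l-\mathbf{F}_l^H\mathbf{S}_l\mathbf{T}_l$.
   Context: Fading MIMO broadcast channel with $L$ receivers, statistical CSI at the transmitter and linear assignment. For $l=1,\dots,L$ define $\boldsymbol{\Sigma}_{S,l}=\sum_{t=1}^{l-1}\boldsymbol{\Sigma}_t$ (the zero matrix for $l=1$), $\mathbf{A}_l=\mathbf{F}_l\boldsymbol{\Sigma}_{S,l}+\boldsymbol{\Sigma}_l$, $\mathbf{B}_l=\boldsymbol{\Sigma}_{S,l}+\boldsymbol{\Sigma}_l$, $\mathbf{C}_l=\mathbf{F}_l\boldsymbol{\Sigma}_{S,l}\mathbf{F}_l^H+\boldsymbol{\Sigma}_l$, $\boldsymbol{\Sigma}_{Z,l}(\mathbf{H}_l)=\mathbf{H}_l\big(\sum_{t=l+1}^L\boldsymbol{\Sigma}_t\big)\mathbf{H}_l^H+N_0\mathbf{I}_{N_r}$, $\boldsymbol{\Sigma}_{\mathbf{u}_l|\mathbf{y}_l,\mathbf{H}_l}(\mathbf{H}_l)=\mathbf{C}_l-\mathbf{A}_l\mathbf{H}_l^H\big[\mathbf{H}_l\mathbf{B}_l\mathbf{H}_l^H+\boldsymbol{\Sigma}_{Z,l}(\mathbf{H}_l)\big]^{-1}\mathbf{H}_l\mathbf{A}_l^H$, $\mathbf{T}_l(\mathbf{H}_l)=\mathbf{A}_l\mathbf{H}_l^H\big[\mathbf{H}_l\mathbf{B}_l\mathbf{H}_l^H+\boldsymbol{\Sigma}_{Z,l}(\mathbf{H}_l)\big]^{-1}\mathbf{H}_l$. The linear assignment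 achievable rate of receiver $l$ is $R_l=\log_2\det(\boldsymbol{\Sigma}_l)-E\big[\log_2\det\boldsymbol{\Sigma}_{\mathbf{u}_l|\mathbf{y}_l,\mathbf{H}_l}(\mathbf{H}_l)\big]$, and the weighted sum-rate is $R_{\rm sum}^{\rm w}=\sum_{l=1}^L\mu_lR_l$. $E_{\mathbf{H}_l}$ denotes expectation over $\mathbf{H}_l$. *)

theory Defs
  imports "HOL-Probability.Probability"
begin

text \<open>Complex matrices are represented as complex^'c^'r (r rows, c columns);
  dimensions N_t, N_r are the cardinalities of finite index types.
  Receivers are indexed by l in {1..L}; matrix families are functions nat => matrix.\<close>

definition hadj :: "complex^'c^'r \<Rightarrow> complex^'r^'c" where
  "hadj A = (\<chi> i j. cnj (A $ j $ i))"

definition log2det :: "complex^'n^'n \<Rightarrow> real" where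
  "log2det X = log 2 (Re (det X))"

definition SigS :: "(nat \<Rightarrow> complex^'t^'t) \<Rightarrow> nat \<Rightarrow> complex^'t^'t" where
  "SigS Sig l = (\<Sum>t\<in>{1..<l}. Sig t)"

definition Amat :: "(nat \<Rightarrow> complex^'t^'t) \<Rightarrow> (nat \<Rightarrow> complex^'t^'t) \<Rightarrow> nat \<Rightarrow> complex^'t^'t" where
  "Amat F Sig l = F l ** SigS Sig l + Sig l"

definition Bmat :: "(nat \<Rightarrow> complex^'t^'t) \<Rightarrow> nat \<Rightarrow> complex^'t^'t" where
  "Bmat Sig l = SigS Sig l + Sig l"

definition Cmat :: "(nat \<Rightarrow> complex^'t^'t) \<Rightarrow> (nat \<Rightarrow> complex^'t^'t) \<Rightarrow> nat \<Rightarrow> complex^'t^'t" where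
  "Cmat F Sig l = F l ** SigS Sig l ** hadj (F l) + Sig l"

definition SigZ :: "nat \<Rightarrow> real \<Rightarrow> (nat \<Rightarrow> complex^'t^'t) \<Rightarrow> nat \<Rightarrow> complex^'t^'r \<Rightarrow> complex^'r^'r" where
  "SigZ L N0 Sig l H = H ** (\<Sum>t\<in>{l+1..L}. Sig t) ** hadj H + mat (complex_of_real N0)"

definition SigUY :: "nat \<Rightarrow> real \<Rightarrow> (nat \<Rightarrow> complex^'t^'t) \<Rightarrow> (nat \<Rightarrow> complex^'t^'t) \<Rightarrow> nat \<Rightarrow> complex^'t^'r \<Rightarrow> complex^'t^'t" where
  "SigUY L N0 F Sig l H =
     Cmat F Sig l - Amat F Sig l ** hadj H **
       matrix_inv (H ** Bmat Sig l ** hadj H + SigZ L N0 Sig l H) ** H ** hadj (Amat F Sig l)"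

definition Tmat :: "nat \<Rightarrow> real \<Rightarrow> (nat \<Rightarrow> complex^'t^'t) \<Rightarrow> (nat \<Rightarrow> complex^'t^'t) \<Rightarrow> nat \<Rightarrow> complex^'t^'r \<Rightarrow> complex^'t^'t" where
  "Tmat L N0 F Sig l H =
     Amat F Sig l ** hadj H ** matrix_inv (H ** Bmat Sig l ** hadj H + SigZ L N0 Sig l H) ** H"

definition SigOf :: "(nat \<Rightarrow> complex^'t^'t) \<Rightarrow> nat \<Rightarrow> complex^'t^'t" where
  "SigOf P l = P l ** hadj (P l)"

definition rate :: "'w measure \<Rightarrow> (nat \<Rightarrow> 'w \<Rightarrow> complex^'t^'r) \<Rightarrow> nat \<Rightarrow> real \<Rightarrow>
    (nat \<Rightarrow> complex^'t^'t) \<Rightarrow> (nat \<Rightarrow> complex^'t^'t) \<Rightarrow> nat \<Rightarrow> real" where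
  "rate M H L N0 F P l =
     log2det (SigOf P l) - (\<integral>\<omega>. log2det (SigUY L N0 F (SigOf P) l (H l \<omega>)) \<partial>M)"

definition wsum_rate :: "'w measure \<Rightarrow> (nat \<Rightarrow> 'w \<Rightarrow> complex^'t^'r) \<Rightarrow> nat \<Rightarrow> real \<Rightarrow> (nat \<Rightarrow> real) \<Rightarrow>
    (nat \<Rightarrow> complex^'t^'t) \<Rightarrow> (nat \<Rightarrow> complex^'t^'t) \<Rightarrow> real" where
  "wsum_rate M H L N0 \<mu> F P = (\<Sum>l\<in>{1..L}. \<mu> l * rate M H L N0 F P l)"

definition feasible :: "nat \<Rightarrow> real \<Rightarrow> (nat \<Rightarrow> complex^'t^'t) \<Rightarrow> bool" where
  "feasible L Pw P \<longleftrightarrow> (\<forall>l\<in>{1..L}. invertible (P l)) \<and>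
     (\<Sum>l\<in>{1..L}. Re (trace (P l ** hadj (P l)))) \<le> Pw"

definition optimal_design :: "'w measure \<Rightarrow> (nat \<Rightarrow> 'w \<Rightarrow> complex^'t^'r) \<Rightarrow> nat \<Rightarrow> real \<Rightarrow> real \<Rightarrow>
    (nat \<Rightarrow> real) \<Rightarrow> (nat \<Rightarrow> complex^'t^'t) \<Rightarrow> (nat \<Rightarrow> complex^'t^'t) \<Rightarrow> bool" where
  "optimal_design M H L N0 Pw \<mu> F P \<longleftrightarrow> feasible L Pw P \<and>
     (\<forall>F' P'. feasible L Pw P' \<longrightarrow> wsum_rate M H L N0 \<mu> F' P' \<le> wsum_rate M H L N0 \<mu> F P)"

end

theory Submission
  imports Defs
begin

text \<open>
  The matrix SigUY is the error covariance of the linear MMSE estimate of u from y. For an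
  arbitrary linear estimator G the error covariance mse(G) is quadratic in F and affine in the
  covariances, and completing the square gives mse(G) = SigUY + (G - G0) W (G - G0)^H, where G0 is
  the MMSE estimator and W the covariance of y. Let (F, P) be optimal and keep, for each
  realisation of the channel, the estimator G0 that belongs to (F, P). For any other feasible
  design (F', P') the tangent inequality for the concave function log det then yields

    log det SigUY' <= log det SigUY + tr (SigUY^-1 (mse'(G0) - SigUY)).

  Taking expectations, (F, P) also maximises a surrogate that consists of the terms log det (P' P'^H)
  and of a quadratic form whose coefficients are the expectations of the matrices G1, G2, G3. So
  no derivative is ever moved under an expectation, and the conditions (i)-(vi) are the
  Karush-Kuhn-Tucker conditions of the surrogate. The expectations exist because T is a bounded
  function of H and SigUY^-1 is bounded by a multiple of 1 + |H|^2. The real inner product on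
  matrices used throughout is Re tr (A B^H).
\<close>

section \<open>Complex matrices and the adjoint\<close>

lemma hadj_hadj [simp]: "hadj (hadj A) = A"
  by (simp add: hadj_def vec_eq_iff)

lemma hadj_mult: "hadj (A ** B) = hadj B ** hadj A"
  by (simp add: hadj_def matrix_matrix_mult_def vec_eq_iff mult.commute)

lemma hadj_add: "hadj (A + B) = hadj A + hadj B"
  by (simp add: hadj_def vec_eq_iff)

lemma hadj_diff: "hadj (A - B) = hadj A - hadj B"
  by (simp add: hadj_def vec_eq_iff)

lemma hadj_zero [simp]: "hadj 0 = 0"
  by (simp add: hadj_def vec_eq_iff)

lemma hadj_sum: "hadj (\<Sum>i\<in>I. f i) = (\<Sum>i\<in>I. hadj (f i))"
  by (induction I rule: infinite_finite_induct) (auto simp: hadj_add)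

lemma hadj_scaleR: "hadj (c *\<^sub>R A) = c *\<^sub>R hadj A"
  by (simp add: hadj_def vec_eq_iff)

lemma hadj_mat_1 [simp]: "hadj (mat 1) = mat 1"
  by (auto simp: hadj_def vec_eq_iff mat_def)

lemma linear_hadj: "linear hadj"
  by (rule linearI) (simp_all add: hadj_add hadj_scaleR)

lemma bounded_linear_hadj: "bounded_linear hadj"
  by (simp add: linear_conv_bounded_linear[symmetric] linear_hadj)

lemma det_hadj: "det (hadj A) = cnj (det (A :: complex^'n^'n))"
proof -
  have "hadj A = (\<chi> i j. cnj (transpose A $ i $ j))"
    by (simp add: hadj_def transpose_def)
  then have "det (hadj A) = cnj (det (transpose A))"
    by (simp add: det_def)
  then show ?thesis by simp
qed

lemma bounded_bilinear_matrix_mult: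
  "bounded_bilinear ((**) :: complex^'n^'m \<Rightarrow> complex^'p^'n \<Rightarrow> complex^'p^'m)"
proof -
  have "bilinear ((**) :: complex^'n^'m \<Rightarrow> complex^'p^'n \<Rightarrow> complex^'p^'m)"
    unfolding bilinear_def
    by (auto intro!: linearI simp: matrix_matrix_mult_def vec_eq_iff sum.distrib
        algebra_simps scaleR_sum_right)
  then show ?thesis by (simp add: bilinear_conv_bounded_bilinear)
qed

interpretation mm: bounded_bilinear "(**) :: complex^'n^'m \<Rightarrow> complex^'p^'n \<Rightarrow> complex^'p^'m"
  by (rule bounded_bilinear_matrix_mult)

lemma bounded_bilinear_matrix_vector_mult:
  "bounded_bilinear ((*v) :: complex^'n^'m \<Rightarrow> complex^'n \<Rightarrow> complex^'m)"
proof -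
  have "bilinear ((*v) :: complex^'n^'m \<Rightarrow> complex^'n \<Rightarrow> complex^'m)"
    unfolding bilinear_def
    by (auto intro!: linearI simp: matrix_vector_mult_def vec_eq_iff sum.distrib
        algebra_simps scaleR_sum_right)
  then show ?thesis by (simp add: bilinear_conv_bounded_bilinear)
qed

interpretation mv: bounded_bilinear "(*v) :: complex^'n^'m \<Rightarrow> complex^'n \<Rightarrow> complex^'m"
  by (rule bounded_bilinear_matrix_vector_mult)

section \<open>The real inner product of complex vectors and matrices\<close>

lemma inner_complex_eq_Re: "x \<bullet> y = Re (x * cnj y)"
  by (simp add: inner_complex_def)

text \<open>The inner product on \<open>complex^'n\<close> is the real part of the Hermitian one;
  its adjoint operation is the conjugate transpose.\<close>

lemma inner_matrix_vector_hadj: "(A *v x) \<bullet> y = x \<bullet> (hadj A *v y)"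
  for A :: "complex^'n^'m"
proof -
  have "(A *v x) \<bullet> y = (\<Sum>i\<in>UNIV. \<Sum>j\<in>UNIV. Re (A $ i $ j * x $ j * cnj (y $ i)))"
    unfolding inner_vec_def matrix_vector_mult_def inner_complex_eq_Re vec_lambda_beta
      sum_distrib_right Re_sum ..
  also have "\<dots> = (\<Sum>j\<in>UNIV. \<Sum>i\<in>UNIV. Re (A $ i $ j * x $ j * cnj (y $ i)))"
    by (rule sum.swap)
  also have "\<dots> = (\<Sum>j\<in>UNIV. \<Sum>i\<in>UNIV. Re (x $ j * cnj (cnj (A $ i $ j) * y $ i)))"
    by (intro sum.cong refl arg_cong[of _ _ Re]) simp
  also have "\<dots> = x \<bullet> (hadj A *v y)"
    unfolding inner_vec_def matrix_vector_mult_def inner_complex_eq_Re vec_lambda_beta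
      cnj_sum sum_distrib_left Re_sum hadj_def ..
  finally show ?thesis .
qed

lemma Re_trace_mult: "Re (trace (A ** B)) = A \<bullet> hadj B" for A :: "complex^'n^'m"
  by (simp add: trace_def matrix_matrix_mult_def inner_vec_def hadj_def inner_complex_def)

lemma inner_hadj: "hadj A \<bullet> hadj B = A \<bullet> B" for A :: "complex^'n^'m"
  by (simp add: inner_vec_def hadj_def inner_complex_def) (rule sum.swap)

text \<open>Cyclicity of the trace. Here and in \<open>matrix_inner_mult_right\<close> a factor
  crosses the inner product as its adjoint.\<close>

lemma matrix_inner_mult_left: "(A ** B) \<bullet> C = B \<bullet> (hadj A ** C)" for A :: "complex^'n^'m"
proof -
  have "(A ** B) \<bullet> C = Re (trace ((A ** B) ** hadj C))" by (simp add: Re_trace_mult)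
  also have "\<dots> = Re (trace (B ** (hadj C ** A)))"
    using trace_mul_sym[of A "B ** hadj C"] by (simp add: matrix_mul_assoc)
  finally show ?thesis by (simp add: Re_trace_mult hadj_mult)
qed

lemma matrix_inner_mult_right: "(A ** B) \<bullet> C = A \<bullet> (C ** hadj B)" for A :: "complex^'n^'m"
proof -
  have "(A ** B) \<bullet> C = Re (trace ((A ** B) ** hadj C))" by (simp add: Re_trace_mult)
  also have "\<dots> = Re (trace (A ** (B ** hadj C)))"
    by (simp add: matrix_mul_assoc)
  finally show ?thesis by (simp add: Re_trace_mult hadj_mult)
qed

lemma Re_trace_gram: "Re (trace (A ** hadj A)) = (norm A)\<^sup>2" for A :: "complex^'n^'m"
  by (simp add: Re_trace_mult power2_norm_eq_inner)

section \<open>Inverses of matrices\<close>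

lemma matrix_inv_mult:
  assumes "invertible A"
  shows "A ** matrix_inv A = mat 1" "matrix_inv A ** A = mat 1"
  using someI_ex[of "\<lambda>B. A ** B = mat 1 \<and> B ** A = mat 1"] assms
  unfolding invertible_def matrix_inv_def by auto

lemma matrix_inv_unique:
  fixes A :: "complex^'n^'n"
  assumes "A ** B = mat 1"
  shows "matrix_inv A = B"
proof -
  have "invertible A" using assms invertible_right_inverse by blast
  then have "B = (matrix_inv A ** A) ** B" by (simp add: matrix_inv_mult)
  also have "\<dots> = matrix_inv A" by (simp add: assms flip: matrix_mul_assoc)
  finally show ?thesis by simp
qed

lemma invertible_hadj: "invertible A \<Longrightarrow> invertible (hadj A)" for A :: "complex^'n^'n"
  by (simp add: invertible_det_nz det_hadj)

lemma matrix_inv_hadj: "invertible A \<Longrightarrow> matrix_inv (hadj A) = hadj (matrix_inv A)"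
  for A :: "complex^'n^'n"
  by (rule matrix_inv_unique) (simp add: matrix_inv_mult flip: hadj_mult)

lemma matrix_inv_gram:
  fixes A :: "complex^'n^'n"
  assumes "invertible A"
  shows "matrix_inv (A ** hadj A) = hadj (matrix_inv A) ** matrix_inv A"
proof (rule matrix_inv_unique)
  have "hadj A ** hadj (matrix_inv A) = mat 1"
    by (simp add: matrix_inv_mult[OF assms] flip: hadj_mult)
  then have "A ** (hadj A ** hadj (matrix_inv A)) ** matrix_inv A = mat 1"
    by (simp add: matrix_inv_mult[OF assms])
  then show "(A ** hadj A) ** (hadj (matrix_inv A) ** matrix_inv A) = mat 1"
    by (simp add: matrix_mul_assoc)
qed

text \<open>The Leibniz formula is differentiated termwise. A permutation other than the identity
  moves at least two indices, so a zero off-diagonal entry remains after one factor is removed; only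
  the identity contributes.\<close>

lemma det_has_derivative_mat_1:
  "(det has_derivative trace) (at (mat 1 :: complex^'n^'n))"
proof -
  let ?P = "{p. p permutes (UNIV :: 'n set)}"
  let ?d = "\<lambda>K :: complex^'n^'n. \<lambda>p. \<Sum>i\<in>UNIV. K $ i $ p i * (\<Prod>j\<in>UNIV - {i}. mat 1 $ j $ p j)"
  have bl: "bounded_linear (\<lambda>A :: complex^'n^'n. A $ i $ j)" for i j
    by (rule bounded_linear_compose[OF bounded_linear_vec_nth bounded_linear_vec_nth])
  have *: "((\<lambda>A. \<Sum>p\<in>?P. of_int (sign p) * (\<Prod>i\<in>UNIV. A $ i $ p i)) has_derivative
      (\<lambda>K. \<Sum>p\<in>?P. of_int (sign p) * ?d K p)) (at (mat 1 :: complex^'n^'n))"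
    by (intro has_derivative_sum has_derivative_mult_right has_derivative_prod
        bounded_linear_imp_has_derivative bl)
  have d: "?d K p = (if p = id then trace K else 0)" if p: "p \<in> ?P" for K :: "complex^'n^'n" and p
  proof (cases "p = id")
    case True
    then show ?thesis by (simp add: trace_def mat_def)
  next
    case False
    have "(\<Prod>j\<in>UNIV - {i}. (mat 1 :: complex^'n^'n) $ j $ p j) = 0" for i
    proof -
      \<comment> \<open>If \<open>p\<close> fixed every index except \<open>i\<close>, injectivity
        would force it to fix \<open>i\<close> too.\<close>
      obtain j where j: "j \<noteq> i" "p j \<noteq> j"
      proof (rule ccontr)
        assume "\<not> thesis"
        then have "p j = j" if "j \<noteq> i" for j using that \<open>\<And>j. \<lbrakk>j \<noteq> i; p j \<noteq> j\<rbrakk> \<Longrightarrow> thesis\<close> by blast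
        moreover from this have "p i = i"
          using p by (metis mem_Collect_eq permutes_inj inj_eq)
        ultimately have "p = id" by (intro ext) (metis id_apply)
        with False show False by simp
      qed
      then have "(mat 1 :: complex^'n^'n) $ j $ p j = 0" by (simp add: mat_def)
      with j show ?thesis by (intro prod_zero) (auto intro!: bexI[of _ j])
    qed
    then show ?thesis using False by (simp only: mult_zero_right sum.neutral_const if_False)
  qed
  have "(\<Sum>p\<in>?P. of_int (sign p) * ?d K p) = trace K" for K :: "complex^'n^'n"
  proof -
    have "(\<Sum>p\<in>?P. of_int (sign p) * ?d K p)
        = (\<Sum>p\<in>?P. if p = id then of_int (sign p) * trace K else 0)"
      by (rule sum.cong[OF refl]) (simp only: d, auto)
    also have "\<dots> = trace K"
      by (simp add: sum.delta' finite_permutations permutes_id sign_id)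
    finally show ?thesis .
  qed
  with * show ?thesis by (simp add: det_def[abs_def])
qed

text \<open>Jacobi's formula, transported from the identity by det X = det Y det (Y^-1 X).\<close>

lemma det_has_derivative:
  fixes Y :: "complex^'n^'n"
  assumes "invertible Y"
  shows "(det has_derivative (\<lambda>K. det Y * trace (matrix_inv Y ** K))) (at Y)"
proof -
  have "det X = det Y * det (matrix_inv Y ** X)" for X
    using det_mul[of Y "matrix_inv Y ** X"] by (simp add: matrix_inv_mult[OF assms] matrix_mul_assoc)
  then have eq: "det = (\<lambda>X. det Y * det (matrix_inv Y ** X))" by (rule ext)
  have "((\<lambda>X. matrix_inv Y ** X) has_derivative (\<lambda>K. matrix_inv Y ** K)) (at Y)"
    by (intro bounded_linear_imp_has_derivative mm.bounded_linear_right)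
  then have "((\<lambda>X. det (matrix_inv Y ** X)) has_derivative (\<lambda>K. trace (matrix_inv Y ** K))) (at Y)"
    by (rule has_derivative_compose)
      (simp add: matrix_inv_mult[OF assms] det_has_derivative_mat_1)
  then show ?thesis by (subst eq) (rule has_derivative_mult_right)
qed

lemma continuous_on_det [continuous_intros]:
  fixes f :: "'a::topological_space \<Rightarrow> complex^'n^'n"
  shows "continuous_on S f \<Longrightarrow> continuous_on S (\<lambda>x. det (f x))"
  unfolding det_def by (intro continuous_intros)

text \<open>Cramer's rule for each column of the inverse. The entries become quotients of
  determinants, which makes continuity of inversion visible.\<close>

lemma matrix_inv_cofactor:
  fixes A :: "complex^'n^'n"
  assumes "invertible A"
  shows "matrix_inv A = (\<chi> i j. det (\<chi> k l. if l = i then axis j 1 $ k else A $ k $ l) / det A)"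
proof -
  have "A *v (matrix_inv A *v axis j 1) = axis j 1" for j
    by (simp add: matrix_vector_mul_assoc matrix_inv_mult[OF assms])
  then have "matrix_inv A *v axis j 1
      = (\<chi> i. det (\<chi> k l. if l = i then axis j 1 $ k else A $ k $ l) / det A)" for j
    using cramer[of A] assms by (simp add: invertible_det_nz)
  moreover have "(matrix_inv A *v axis j 1) $ i = matrix_inv A $ i $ j" for i j
    by (simp add: matrix_vector_mult_def axis_def if_distrib cong: if_cong)
  ultimately show ?thesis by (metis (lifting) vec_lambda_beta vec_lambda_unique)
qed

lemma continuous_on_matrix_inv:
  fixes f :: "'a::topological_space \<Rightarrow> complex^'n^'n"
  assumes "continuous_on S f" "\<And>x. x \<in> S \<Longrightarrow> invertible (f x)"
  shows "continuous_on S (\<lambda>x. matrix_inv (f x))"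
proof -
  have *: "continuous_on S (\<lambda>x. if l = i then c else f x $ k $ l)" for l i k c
    by (cases "l = i") (simp_all add: continuous_on_component assms(1))
  have "continuous_on S
    (\<lambda>x. \<chi> i j. det (\<chi> k l. if l = i then axis j 1 $ k else f x $ k $ l) / det (f x))"
    by (intro continuous_intros assms(1) *) (simp add: assms(2) flip: invertible_det_nz)
  then show ?thesis
    by (rule continuous_on_cong[THEN iffD1, rotated -1]) (simp_all add: matrix_inv_cofactor assms(2))
qed

section \<open>Concavity of the logarithm of the determinant\<close>

definition psd :: "complex^'n^'n \<Rightarrow> bool" where
  "psd A \<longleftrightarrow> hadj A = A \<and> (\<forall>x. 0 \<le> x \<bullet> (A *v x))"

definition pd :: "complex^'n^'n \<Rightarrow> bool" where
  "pd A \<longleftrightarrow> hadj A = A \<and> (\<forall>x. x \<noteq> 0 \<longrightarrow> 0 < x \<bullet> (A *v x))"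

text \<open>
  The dual cone of the positive semidefinite matrices is that same cone, but only the easy
  inclusion, obtained from an explicit factorisation V V^H, is needed; this avoids the spectral
  theorem.
\<close>

definition psd_dual :: "complex^'n^'n \<Rightarrow> bool" where
  "psd_dual X \<longleftrightarrow> (\<forall>Z. psd Z \<longrightarrow> 0 \<le> X \<bullet> Z)"

section \<open>Positive definite matrices: inverses, segments, determinants\<close>

lemma pd_imp_psd: "pd A \<Longrightarrow> psd A"
  unfolding pd_def psd_def by (metis inner_zero_left order.refl less_imp_le)

lemma pd_imp_invertible: "pd A \<Longrightarrow> invertible A"
proof -
  assume A: "pd A"
  have "x = 0" if "A *v x = 0" for x
    using A that unfolding pd_def by (metis inner_zero_right less_irrefl)
  then show "invertible A"
    by (simp add: invertible_left_inverse matrix_left_invertible_ker)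
qed

lemma pd_matrix_inv:
  assumes "pd A"
  shows "pd (matrix_inv A)"
  unfolding pd_def
proof (intro conjI allI impI)
  note inv = pd_imp_invertible[OF assms]
  show herm: "hadj (matrix_inv A) = matrix_inv A"
    using matrix_inv_hadj[OF inv] assms by (simp add: pd_def)
  fix x :: "complex^'a" assume "x \<noteq> 0"
  have x: "x = A *v (matrix_inv A *v x)"
    by (simp add: matrix_vector_mul_assoc matrix_inv_mult[OF inv])
  with \<open>x \<noteq> 0\<close> have "matrix_inv A *v x \<noteq> 0" by (metis mv.zero_right)
  then have "0 < (matrix_inv A *v x) \<bullet> (A *v (matrix_inv A *v x))"
    using assms by (simp add: pd_def)
  then show "0 < x \<bullet> (matrix_inv A *v x)"
    using x by (simp add: inner_commute)
qed

lemma hermitian_matrix_inv_pd: "pd A \<Longrightarrow> hadj (matrix_inv A) = matrix_inv A"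
  using pd_matrix_inv pd_def by blast

lemma pd_mat_1: "pd (mat 1)"
  by (simp add: pd_def)

lemma pd_convex_combination:
  assumes "pd A" "pd B" "0 \<le> s" "s \<le> 1"
  shows "pd (A + s *\<^sub>R (B - A))"
  unfolding pd_def
proof (intro conjI allI impI)
  show "hadj (A + s *\<^sub>R (B - A)) = A + s *\<^sub>R (B - A)"
    using assms by (simp add: pd_def hadj_add hadj_diff hadj_scaleR)
  fix x :: "complex^'a" assume x: "x \<noteq> 0"
  have "x \<bullet> ((A + s *\<^sub>R (B - A)) *v x) = (1 - s) * (x \<bullet> (A *v x)) + s * (x \<bullet> (B *v x))"
    by (simp add: mv.add_left mv.diff_left mv.scaleR_left inner_add_right inner_diff_right
        algebra_simps)
  moreover have "0 < \<dots>"
  proof (cases "s = 0")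
    case True
    then show ?thesis using assms x by (simp add: pd_def)
  next
    case False
    then have "0 < s * (x \<bullet> (B *v x))" using assms x by (simp add: pd_def)
    moreover have "0 \<le> (1 - s) * (x \<bullet> (A *v x))" using assms x by (simp add: pd_def less_imp_le)
    ultimately show ?thesis by simp
  qed
  ultimately show "0 < x \<bullet> ((A + s *\<^sub>R (B - A)) *v x)" by simp
qed

lemma det_hermitian: "hadj A = A \<Longrightarrow> det A = complex_of_real (Re (det A))"
  for A :: "complex^'n^'n"
  using det_hadj[of A] by (simp add: complex_eq_iff)

text \<open>On the segment from the identity to \<open>A\<close> all matrices are positive definite,
  so the determinant is real and never zero. It starts at 1, hence stays positive by the
  intermediate value theorem.\<close>

lemma det_pd_pos:
  fixes A :: "complex^'n^'n"
  assumes "pd A"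
  shows "0 < Re (det A)"
proof (rule ccontr)
  let ?Y = "\<lambda>s. mat 1 + s *\<^sub>R (A - mat 1)"
  assume "\<not> 0 < Re (det A)"
  then have "Re (det (?Y 1)) \<le> 0" by simp
  moreover have "0 \<le> Re (det (?Y 0))" by simp
  moreover have "continuous_on {0..1} (\<lambda>s. Re (det (?Y s)))"
    by (intro continuous_intros)
  ultimately obtain s where s: "0 \<le> s" "s \<le> 1" "Re (det (?Y s)) = 0"
    using IVT2'[of "\<lambda>s. Re (det (?Y s))" 1 0 0] by auto
  have "pd (?Y s)" using pd_convex_combination[OF pd_mat_1 assms s(1,2)] .
  then have "det (?Y s) \<noteq> 0" "hadj (?Y s) = ?Y s"
    using pd_imp_invertible invertible_det_nz by (blast, simp add: pd_def)
  with s(3) show False using det_hermitian by fastforce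
qed

section \<open>Congruences and the dual cone\<close>

lemma psd_congruence:
  assumes "psd Z"
  shows "psd (hadj V ** Z ** V)"
  unfolding psd_def
proof (intro conjI allI)
  show "hadj (hadj V ** Z ** V) = hadj V ** Z ** V"
    using assms by (simp add: psd_def hadj_mult matrix_mul_assoc)
  fix x
  have "x \<bullet> ((hadj V ** Z ** V) *v x) = (V *v x) \<bullet> (Z *v (V *v x))"
    by (simp add: inner_matrix_vector_hadj matrix_vector_mul_assoc matrix_mul_assoc)
  then show "0 \<le> x \<bullet> ((hadj V ** Z ** V) *v x)"
    using assms by (simp add: psd_def)
qed

text \<open>The trace of V^H Z V sums the quadratic form of \<open>Z\<close> over the columns of
  \<open>V\<close>.\<close>

lemma inner_mult_psd_nonneg:
  fixes V :: "complex^'m^'n"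
  assumes "psd Z"
  shows "0 \<le> V \<bullet> (Z ** V)"
proof -
  have "V \<bullet> (Z ** V) = (\<Sum>j\<in>UNIV. column j V \<bullet> (Z *v column j V))"
    unfolding inner_vec_def matrix_matrix_mult_def matrix_vector_mult_def column_def vec_lambda_beta
    by (rule sum.swap)
  also have "\<dots> \<ge> 0" using assms by (intro sum_nonneg) (simp add: psd_def)
  finally show ?thesis .
qed

lemma psd_dual_gram: "psd_dual (V ** hadj V)"
  unfolding psd_dual_def by (auto simp: matrix_inner_mult_right inner_mult_psd_nonneg)

lemma psd_dual_add: "psd_dual X \<Longrightarrow> psd_dual Y \<Longrightarrow> psd_dual (X + Y)"
  by (simp add: psd_dual_def inner_add_left)

lemma psd_dual_sum: "(\<And>i. i \<in> I \<Longrightarrow> psd_dual (f i)) \<Longrightarrow> psd_dual (\<Sum>i\<in>I. f i)"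
  by (simp add: psd_dual_def inner_sum_left sum_nonneg)

lemma psd_dual_scaleR: "0 \<le> c \<Longrightarrow> psd_dual X \<Longrightarrow> psd_dual (c *\<^sub>R X)"
  by (simp add: psd_dual_def)

lemma psd_dual_congruence:
  assumes "psd_dual X"
  shows "psd_dual (V ** X ** hadj V)"
  unfolding psd_dual_def
proof (intro allI impI)
  fix Z :: "complex^'b^'b" assume "psd Z"
  have "(V ** X ** hadj V) \<bullet> Z = X \<bullet> (hadj V ** Z ** V)"
    unfolding matrix_inner_mult_right[of "V ** X"] matrix_inner_mult_left[of V]
    by (simp add: matrix_mul_assoc)
  then show "0 \<le> (V ** X ** hadj V) \<bullet> Z"
    using assms psd_congruence[OF \<open>psd Z\<close>, of V] by (simp add: psd_dual_def)
qed

text \<open>Jacobi's formula and the chain rule. At a positive definite point the determinant is a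
  positive real, so it leaves the real part and cancels against the derivative of
  \<open>ln\<close>.\<close>

lemma ln_det_has_real_derivative:
  assumes X: "(X has_vector_derivative X') (at s)" and pd: "pd (X s)"
  shows "((\<lambda>s. ln (Re (det (X s)))) has_real_derivative matrix_inv (X s) \<bullet> X') (at s)"
proof -
  let ?d = "det (X s)"
  have inv: "invertible (X s)" and herm: "hadj (X s) = X s"
    using pd pd_imp_invertible by (auto simp: pd_def)
  have d: "?d = complex_of_real (Re ?d)" "Re ?d > 0"
    using det_hermitian[OF herm] det_pd_pos[OF pd] by auto
  have "((\<lambda>s. det (X s)) has_derivative (\<lambda>h. ?d * trace (matrix_inv (X s) ** (h *\<^sub>R X')))) (at s)"
    using has_derivative_compose[OF X[unfolded has_vector_derivative_def] det_has_derivative[OF inv]] .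
  from has_derivative_Re[OF this]
  have "((\<lambda>s. Re (det (X s))) has_derivative
      (\<lambda>h. Re (?d * trace (matrix_inv (X s) ** (h *\<^sub>R X'))))) (at s)" .
  moreover have "Re (?d * trace (matrix_inv (X s) ** (h *\<^sub>R X')))
      = Re ?d * (matrix_inv (X s) \<bullet> X') * h" for h
  proof -
    have "Re (?d * trace (matrix_inv (X s) ** (h *\<^sub>R X')))
        = Re ?d * Re (trace (matrix_inv (X s) ** (h *\<^sub>R X')))"
      by (subst d(1)) simp
    also have "Re (trace (matrix_inv (X s) ** (h *\<^sub>R X')))
        = Re (trace ((h *\<^sub>R X') ** matrix_inv (X s)))"
      by (rule arg_cong[OF trace_mul_sym])
    also have "\<dots> = h * (X' \<bullet> matrix_inv (X s))"
      by (simp add: Re_trace_mult hermitian_matrix_inv_pd[OF pd])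
    finally show ?thesis by (simp add: inner_commute)
  qed
  ultimately have "((\<lambda>s. Re (det (X s))) has_real_derivative Re ?d * (matrix_inv (X s) \<bullet> X')) (at s)"
    by (simp add: has_field_derivative_def)
  from DERIV_chain2[OF DERIV_ln[OF d(2)] this] show ?thesis
    using d(2) by (simp flip: mult.assoc)
qed

text \<open>Concavity of log det without second derivatives: the mean value theorem yields the slope
  at an intermediate point of the segment, and the resolvent identity shows that this slope is at
  most the one at \<open>X0\<close>.\<close>

lemma ln_det_le_tangent:
  assumes X0: "pd X0" "psd_dual X0" and X: "pd X"
  shows "ln (Re (det X)) \<le> ln (Re (det X0)) + matrix_inv X0 \<bullet> (X - X0)"
proof -
  let ?K = "X - X0"
  let ?Y = "\<lambda>s. X0 + s *\<^sub>R ?K"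
  have pdY: "pd (?Y s)" if "0 \<le> s" "s \<le> 1" for s
    using pd_convex_combination[OF X0(1) X that] .
  have "((\<lambda>s. ln (Re (det (?Y s)))) has_real_derivative matrix_inv (?Y s) \<bullet> ?K) (at s)"
    if "0 \<le> s" "s \<le> 1" for s
  proof (rule ln_det_has_real_derivative)
    show "(?Y has_vector_derivative ?K) (at s)"
      by (auto intro!: derivative_eq_intros)
  qed (rule pdY[OF that])
  from MVT2[of 0 1, OF _ this] obtain s where s: "0 < s" "s < 1"
    and eq: "ln (Re (det (?Y 1))) - ln (Re (det (?Y 0))) = matrix_inv (?Y s) \<bullet> ?K"
    by auto
  have invY: "invertible (?Y s)" and inv0: "invertible X0"
    using pdY[of s] s X0(1) pd_imp_invertible by auto
  have hK: "hadj ?K = ?K" using X0 X by (simp add: pd_def hadj_diff)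
  have h0: "hadj (matrix_inv X0) = matrix_inv X0" by (rule hermitian_matrix_inv_pd[OF X0(1)])
  \<comment> \<open>Resolvent identity: \<open>?Y s\<close> is inserted and then split as
    \<open>X0\<close> plus s times \<open>?K\<close>.\<close>
  have "matrix_inv X0 = matrix_inv (?Y s) ** ?Y s ** matrix_inv X0"
    by (simp add: matrix_inv_mult[OF invY])
  also have "\<dots> = matrix_inv (?Y s) ** (?Y s ** matrix_inv X0)"
    by (simp add: matrix_mul_assoc)
  also have "\<dots> = matrix_inv (?Y s) + s *\<^sub>R (matrix_inv (?Y s) ** (?K ** matrix_inv X0))"
    by (simp only: mm.add_left mm.add_right mm.scaleR_left mm.scaleR_right matrix_inv_mult[OF inv0]
        matrix_mul_rid)
  finally have "matrix_inv X0 \<bullet> ?K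
      = matrix_inv (?Y s) \<bullet> ?K + s * ((matrix_inv (?Y s) ** (?K ** matrix_inv X0)) \<bullet> ?K)"
    by (metis inner_add_left inner_scaleR_left)
  moreover have "0 \<le> (matrix_inv (?Y s) ** (?K ** matrix_inv X0)) \<bullet> ?K"
  proof -
    have "(matrix_inv (?Y s) ** (?K ** matrix_inv X0)) \<bullet> ?K
        = matrix_inv (?Y s) \<bullet> (?K ** matrix_inv X0 ** ?K)"
      by (simp only: matrix_inner_mult_right hadj_mult hK h0 matrix_mul_assoc)
    \<comment> \<open>Written as a congruence of \<open>X0\<close>, this product lies in the dual
      cone; no square root of the inverse is required.\<close>
    also have "?K ** matrix_inv X0 ** ?K
        = (?K ** matrix_inv X0) ** X0 ** hadj (?K ** matrix_inv X0)"
    proof -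
      have "(?K ** matrix_inv X0) ** X0 = ?K ** (matrix_inv X0 ** X0)"
        by (simp only: matrix_mul_assoc)
      then have "(?K ** matrix_inv X0) ** X0 = ?K" by (simp add: matrix_inv_mult[OF inv0])
      then show ?thesis by (simp only: hadj_mult hK h0 matrix_mul_assoc)
    qed
    finally show ?thesis
      using psd_dual_congruence[OF X0(2), unfolded psd_dual_def, rule_format,
          OF pd_imp_psd[OF pd_matrix_inv[OF pdY[of s]]]] s
      by (metis inner_commute less_imp_le)
  qed
  ultimately have "matrix_inv (?Y s) \<bullet> ?K \<le> matrix_inv X0 \<bullet> ?K"
    using s by simp
  with eq show ?thesis by simp
qed

text \<open>The tangent at the identity. Together with \<open>ln_det_ge_trace_inv\<close>, which
  evaluates the tangent at \<open>X\<close> in the identity, it encloses log det for the proof of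
  integrability.\<close>

lemma ln_det_le_trace:
  fixes X :: "complex^'n^'n"
  assumes "pd X"
  shows "ln (Re (det X)) \<le> mat 1 \<bullet> (X - mat 1)"
proof -
  have "psd_dual (mat 1 :: complex^'n^'n)" using psd_dual_gram[of "mat 1"] by simp
  from ln_det_le_tangent[OF pd_mat_1 this assms] show ?thesis
    by (simp add: matrix_inv_unique[of "mat 1" "mat 1"])
qed

lemma ln_det_ge_trace_inv:
  fixes X :: "complex^'n^'n"
  assumes "pd X" "psd_dual X"
  shows "ln (Re (det X)) \<ge> - (matrix_inv X \<bullet> (mat 1 - X))"
  using ln_det_le_tangent[OF assms pd_mat_1] by simp

lemma pd_gram:
  fixes A :: "complex^'n^'n"
  assumes "invertible A"
  shows "pd (A ** hadj A)"
  unfolding pd_def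
proof (intro conjI allI impI)
  show "hadj (A ** hadj A) = A ** hadj A" by (simp add: hadj_mult)
  fix x :: "complex^'n" assume "x \<noteq> 0"
  have "hadj A *v x \<noteq> 0"
  proof
    assume "hadj A *v x = 0"
    then have "(matrix_inv (hadj A) ** hadj A) *v x = 0"
      by (metis matrix_vector_mul_assoc mv.zero_right)
    with \<open>x \<noteq> 0\<close> show False by (simp add: matrix_inv_mult invertible_hadj assms)
  qed
  moreover have "x \<bullet> ((A ** hadj A) *v x) = (hadj A *v x) \<bullet> (hadj A *v x)"
    by (simp add: inner_matrix_vector_hadj matrix_vector_mul_assoc)
  ultimately show "0 < x \<bullet> ((A ** hadj A) *v x)" by simp
qed

section \<open>Maximising log-determinants under a power constraint\<close>

text \<open>The product A A^H varies by A D^H + D A^H, and both terms contribute the same inner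
  product of the inverse of A^H with \<open>D\<close>.\<close>

lemma ln_det_gram_has_real_derivative:
  fixes A D :: "complex^'n^'n"
  assumes "invertible A"
  shows "((\<lambda>s. ln (Re (det ((A + s *\<^sub>R D) ** hadj (A + s *\<^sub>R D)))))
    has_real_derivative 2 * (matrix_inv (hadj A) \<bullet> D)) (at 0)"
proof -
  let ?X = "\<lambda>s. (A + s *\<^sub>R D) ** hadj (A + s *\<^sub>R D)"
  have X0: "?X 0 = A ** hadj A" by simp
  have "((\<lambda>s. A + s *\<^sub>R D) has_vector_derivative D) (at 0)"
    by (auto intro!: derivative_eq_intros)
  moreover from bounded_linear.has_vector_derivative[OF bounded_linear_hadj this]
  have "((\<lambda>s. hadj (A + s *\<^sub>R D)) has_vector_derivative hadj D) (at 0)" .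
  ultimately have "(?X has_vector_derivative A ** hadj D + D ** hadj A) (at 0)"
    using mm.has_vector_derivative by fastforce
  from ln_det_has_real_derivative[OF this]
  have "((\<lambda>s. ln (Re (det (?X s)))) has_real_derivative
      matrix_inv (A ** hadj A) \<bullet> (A ** hadj D + D ** hadj A)) (at 0)"
    using pd_gram[OF assms] by simp
  moreover have "matrix_inv (A ** hadj A) \<bullet> (A ** hadj D + D ** hadj A)
      = 2 * (matrix_inv (hadj A) \<bullet> D)"
  proof -
    let ?B = "matrix_inv A"
    have BA: "?B ** A = mat 1" "hadj A ** hadj ?B = mat 1"
      by (simp_all add: matrix_inv_mult[OF assms] flip: hadj_mult)
    have "(hadj ?B ** ?B) \<bullet> (A ** hadj D) = ?B \<bullet> ((?B ** A) ** hadj D)"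
      by (simp add: matrix_inner_mult_left matrix_mul_assoc)
    moreover have "(hadj ?B ** ?B) \<bullet> (D ** hadj A) = hadj ?B \<bullet> (D ** (hadj A ** hadj ?B))"
      by (simp only: matrix_inner_mult_right matrix_mul_assoc)
    moreover have "?B \<bullet> hadj D = hadj ?B \<bullet> D" using inner_hadj[of ?B "hadj D"] by simp
    ultimately show ?thesis
      by (simp add: matrix_inv_gram[OF assms] matrix_inv_hadj[OF assms] inner_add_right BA)
  qed
  ultimately show ?thesis by simp
qed

text \<open>Invertibility is an open condition, so small steps in any direction remain admissible
  and only the power constraint produces a multiplier.\<close>

lemma eventually_invertible_line:
  fixes A D :: "complex^'n^'n"
  assumes "invertible A"
  shows "\<forall>\<^sub>F s in at_right (0::real). invertible (A + s *\<^sub>R D)"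
proof -
  have "isCont (\<lambda>s::real. det (A + s *\<^sub>R D)) 0"
    using continuous_on_eq_continuous_at[of UNIV "\<lambda>s::real. det (A + s *\<^sub>R D)"]
    by (simp add: continuous_intros)
  then have "((\<lambda>s::real. det (A + s *\<^sub>R D)) \<longlongrightarrow> det A) (at_right 0)"
    by (simp add: isCont_def filterlim_at_split)
  then have "\<forall>\<^sub>F s in at_right (0::real). det (A + s *\<^sub>R D) \<noteq> 0"
    using assms by (intro tendsto_imp_eventually_ne) (auto simp: invertible_det_nz)
  then show ?thesis by (simp add: invertible_det_nz)
qed

text \<open>\<open>K\<close> is half the gradient of the objective. If the constraint is slack,
  every direction is admissible and \<open>K\<close> vanishes. If it is active, \<open>K\<close> is
  split orthogonally along \<open>A\<close>: the coefficient is the multiplier, and the remainder is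
  shown to vanish.\<close>

lemma log_det_power_KKT:
  fixes A M :: "'i \<Rightarrow> complex^'n^'n" and w :: "'i \<Rightarrow> real" and c :: real
  assumes I: "finite I" "I \<noteq> {}"
    and inv: "\<And>t. t \<in> I \<Longrightarrow> invertible (A t)"
    and feas: "(\<Sum>t\<in>I. (norm (A t))\<^sup>2) \<le> c"
    and herm: "\<And>t. t \<in> I \<Longrightarrow> hadj (M t) = M t"
    and opt: "\<And>B :: 'i \<Rightarrow> complex^'n^'n. (\<And>t. t \<in> I \<Longrightarrow> invertible (B t)) \<Longrightarrow> (\<Sum>t\<in>I. (norm (B t))\<^sup>2) \<le> c \<Longrightarrow>
      (\<Sum>t\<in>I. w t * ln (Re (det (B t ** hadj (B t)))) - (M t ** B t) \<bullet> B t)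
      \<le> (\<Sum>t\<in>I. w t * ln (Re (det (A t ** hadj (A t)))) - (M t ** A t) \<bullet> A t)"
  shows "\<exists>\<theta>\<ge>0. (\<forall>t\<in>I. w t *\<^sub>R matrix_inv (hadj (A t)) - M t ** A t = \<theta> *\<^sub>R A t)
    \<and> \<theta> * ((\<Sum>t\<in>I. (norm (A t))\<^sup>2) - c) = 0"
proof -
  define K where "K t = w t *\<^sub>R matrix_inv (hadj (A t)) - M t ** A t" for t
  define ip where "ip X Y = (\<Sum>t\<in>I. X t \<bullet> Y t)" for X Y :: "'i \<Rightarrow> complex^'n^'n"
  \<comment> \<open>A direction of ascent that respects the constraint for small steps contradicts
    optimality. The inequality \<open>ip A D < 0\<close> is strict because a direction tangent to
    the sphere can leave the ball.\<close>
  have dir: "ip K D \<le> 0" if D: "(\<Sum>t\<in>I. (norm (A t))\<^sup>2) < c \<or> ip A D < 0" for D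
  proof (rule ccontr)
    assume "\<not> ip K D \<le> 0"
    define g where "g s = (\<Sum>t\<in>I. w t * ln (Re (det ((A t + s *\<^sub>R D t) ** hadj (A t + s *\<^sub>R D t))))
      - (M t ** (A t + s *\<^sub>R D t)) \<bullet> (A t + s *\<^sub>R D t))" for s
    define p where "p s = (\<Sum>t\<in>I. (norm (A t + s *\<^sub>R D t))\<^sup>2)" for s
    have quad: "((\<lambda>s. (M t ** (A t + s *\<^sub>R D t)) \<bullet> (A t + s *\<^sub>R D t)) has_real_derivative
        2 * ((M t ** A t) \<bullet> D t)) (at 0)" if t: "t \<in> I" for t
    proof -
      have "(M t ** D t) \<bullet> A t = (M t ** A t) \<bullet> D t"
        using herm[OF t] by (metis matrix_inner_mult_left inner_commute)
      then have "(M t ** (A t + s *\<^sub>R D t)) \<bullet> (A t + s *\<^sub>R D t)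
          = (M t ** A t) \<bullet> A t + 2 * s * ((M t ** A t) \<bullet> D t) + s\<^sup>2 * ((M t ** D t) \<bullet> D t)" for s
        by (simp add: mm.add_right mm.scaleR_right inner_add_left inner_add_right power2_eq_square
            algebra_simps)
      then show ?thesis by (auto intro!: derivative_eq_intros)
    qed
    have "(g has_real_derivative
        (\<Sum>t\<in>I. w t * (2 * (matrix_inv (hadj (A t)) \<bullet> D t)) - 2 * ((M t ** A t) \<bullet> D t))) (at 0)"
      unfolding g_def
      by (intro DERIV_sum DERIV_diff DERIV_cmult ln_det_gram_has_real_derivative quad inv)
    moreover have "(\<Sum>t\<in>I. w t * (2 * (matrix_inv (hadj (A t)) \<bullet> D t)) - 2 * ((M t ** A t) \<bullet> D t))
        = 2 * ip K D"
      unfolding ip_def K_def sum_distrib_left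
      by (intro sum.cong refl) (simp add: inner_diff_left algebra_simps)
    ultimately have dg: "(g has_real_derivative 2 * ip K D) (at 0)" by simp
    have "\<exists>d>0. \<forall>h>0. h < d \<longrightarrow> g 0 < g (0 + h)"
      using DERIV_pos_inc_right[OF dg] \<open>\<not> ip K D \<le> 0\<close> by simp
    then have ev1: "\<forall>\<^sub>F s in at_right 0. g 0 < g s"
      by (auto simp: eventually_at_right_field)
    have "p = (\<lambda>s. p 0 + 2 * s * ip A D + s\<^sup>2 * ip D D)"
      unfolding p_def ip_def power2_norm_eq_inner
      by (rule ext) (simp add: inner_add_left inner_add_right sum.distrib sum_distrib_left power2_eq_square
          inner_commute algebra_simps)
    then have dp: "(p has_real_derivative 2 * ip A D) (at 0)"
      by (rule ssubst) (auto intro!: derivative_eq_intros)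
    have p0: "p 0 = (\<Sum>t\<in>I. (norm (A t))\<^sup>2)" by (simp add: p_def)
    have ev2: "\<forall>\<^sub>F s in at_right 0. p s < c"
      using D
    proof
      assume "(\<Sum>t\<in>I. (norm (A t))\<^sup>2) < c"
      moreover have "(p \<longlongrightarrow> p 0) (at_right 0)"
        using DERIV_isCont[OF dp] by (simp add: isCont_def filterlim_at_split)
      ultimately show ?thesis using order_tendstoD(2) p0 by metis
    next
      assume "ip A D < 0"
      then have "\<exists>d>0. \<forall>h>0. h < d \<longrightarrow> p (0 + h) < p 0"
        using DERIV_neg_dec_right[OF dp] by simp
      then have "\<forall>\<^sub>F s in at_right 0. p s < p 0"
        by (auto simp: eventually_at_right_field)
      then show ?thesis by (rule eventually_mono) (use feas p0 in linarith)
    qed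
    have ev3: "\<forall>\<^sub>F s in at_right (0::real). \<forall>t\<in>I. invertible (A t + s *\<^sub>R D t)"
      using I(1) by (intro eventually_ball_finite ballI eventually_invertible_line inv)
    obtain s where s: "g 0 < g s" "p s < c" "\<forall>t\<in>I. invertible (A t + s *\<^sub>R D t)"
      using eventually_happens'[OF _ eventually_conj[OF ev1 eventually_conj[OF ev2 ev3]]]
      by (auto simp: trivial_limit_at_right_real)
    have "g s \<le> g 0"
      using opt[of "\<lambda>t. A t + s *\<^sub>R D t"] s unfolding g_def p_def by auto
    with s show False by simp
  qed
  show ?thesis
  proof (cases "(\<Sum>t\<in>I. (norm (A t))\<^sup>2) < c")
    case True
    then have "ip K K \<le> 0" using dir by blast
    then have "\<forall>t\<in>I. K t = 0"
      using I(1) sum_nonneg_eq_0_iff[of I "\<lambda>t. K t \<bullet> K t"]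
        sum_nonneg[of I "\<lambda>t. K t \<bullet> K t"] by (force simp: ip_def)
    then show ?thesis by (intro exI[of _ 0]) (simp add: K_def)
  next
    case False
    have AA: "0 < ip A A"
    proof -
      obtain t where "t \<in> I" using I by blast
      moreover have "A t \<noteq> 0"
        using inv[OF \<open>t \<in> I\<close>] det_0[where 'n = 'n and 'a = complex]
        by (auto simp: invertible_det_nz)
      ultimately show ?thesis unfolding ip_def using I(1) by (intro sum_pos2[of _ t]) auto
    qed
    define \<theta> where "\<theta> = ip K A / ip A A"
    define R where "R t = K t - \<theta> *\<^sub>R A t" for t
    have ip_lin: "ip X (\<lambda>t. Y t + a *\<^sub>R Z t) = ip X Y + a * ip X Z" for X Y Z a
      by (simp add: ip_def inner_add_right sum.distrib sum_distrib_left)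
    have ip_com: "ip X Y = ip Y X" for X Y by (simp add: ip_def inner_commute)
    have R_eq: "R = (\<lambda>t. K t + (- \<theta>) *\<^sub>R A t)" by (auto simp: R_def)
    have AR: "ip A R = 0"
      unfolding R_eq ip_lin using AA by (simp add: \<theta>_def ip_com[of A K])
    have KR: "ip K R = ip R R"
    proof -
      have "ip R R = ip R K + (- \<theta>) * ip R A" using ip_lin[of R K "- \<theta>" A] R_eq by simp
      then show ?thesis using AR by (simp add: ip_com)
    qed
    \<comment> \<open>\<open>R\<close> is tangent to the sphere and not covered by
      \<open>dir\<close>. Tilting it inwards by \<open>d\<close> makes it admissible; afterwards
      \<open>d\<close> tends to 0.\<close>
    have le: "ip R R - d * ip K A \<le> 0" if "d > 0" for d
    proof -
      have "ip A (\<lambda>t. R t + (- d) *\<^sub>R A t) < 0" unfolding ip_lin AR using AA that by simp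
      from dir[OF disjI2[OF this]] show ?thesis unfolding ip_lin KR by simp
    qed
    have "\<theta> \<ge> 0"
    proof -
      \<comment> \<open>The direction is \<open>- A\<close>, written so that \<open>ip_lin\<close>
        applies: reducing the power cannot pay off, which fixes the sign of the multiplier.\<close>
      have "ip A (\<lambda>t. (\<lambda>_. 0) t + (- 1) *\<^sub>R A t) < 0"
        using AA unfolding ip_lin by (simp add: ip_def)
      from dir[OF disjI2[OF this]] have "0 \<le> ip K A" unfolding ip_lin by (simp add: ip_def)
      then show ?thesis using AA by (simp add: \<theta>_def)
    qed
    moreover have "ip R R \<le> 0"
    proof (rule tendsto_le[OF _ tendsto_const, of "at_right (0::real)" "\<lambda>d. ip R R - d * ip K A"])
      show "((\<lambda>d. ip R R - d * ip K A) \<longlongrightarrow> ip R R) (at_right 0)"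
        by (auto intro!: tendsto_eq_intros)
      show "\<forall>\<^sub>F d in at_right 0. ip R R - d * ip K A \<le> 0"
        using le by (auto simp: eventually_at_right_field intro: exI[of _ 1])
    qed simp
    then have "\<forall>t\<in>I. R t = 0"
      using I(1) sum_nonneg_eq_0_iff[of I "\<lambda>t. R t \<bullet> R t"]
        sum_nonneg[of I "\<lambda>t. R t \<bullet> R t"] by (force simp: ip_def)
    then have "\<forall>t\<in>I. K t = \<theta> *\<^sub>R A t" by (simp add: R_def)
    ultimately show ?thesis using False feas by (intro exI[of _ \<theta>]) (simp add: K_def)
  qed
qed

section \<open>Mean square error of linear estimators\<close>

lemma norm_hadj: "norm (hadj A) = norm A" for A :: "complex^'n^'m"
  by (simp add: norm_eq_sqrt_inner inner_hadj)

text \<open>The norm of a matrix is Euclidean in its entries, hence at most the sum of the norms of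
  the columns, which are images of unit vectors.\<close>

lemma norm_matrix_le:
  fixes B :: "complex^'n^'m"
  assumes "\<And>y. norm (B *v y) \<le> k * norm y"
  shows "norm B \<le> real CARD('n) * k"
proof -
  have "norm (hadj B $ j) \<le> k" for j
  proof -
    have "hadj B $ j = (\<chi> i. cnj ((B *v axis j 1) $ i))"
      by (simp add: hadj_def vec_eq_iff matrix_vector_mult_def axis_def if_distrib cong: if_cong)
    then have "norm (hadj B $ j) = norm (B *v axis j 1)" by (simp add: norm_vec_def)
    also have "\<dots> \<le> k * norm (axis j (1::complex))" by (rule assms)
    finally show ?thesis by simp
  qed
  then have "(\<Sum>j\<in>UNIV. norm (hadj B $ j)) \<le> (\<Sum>j\<in>(UNIV::'n set). k)" by (intro sum_mono)
  moreover have "norm (hadj B) \<le> (\<Sum>j\<in>UNIV. norm (hadj B $ j))"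
    unfolding norm_vec_def[of "hadj B"] by (rule L2_set_le_sum) simp
  ultimately show ?thesis by (simp add: norm_hadj)
qed

lemma quadratic_form_congruence:
  "x \<bullet> ((V ** Z ** hadj V) *v x) = (hadj V *v x) \<bullet> (Z *v (hadj V *v x))"
  for V :: "complex^'n^'m"
  by (simp add: inner_matrix_vector_hadj matrix_vector_mul_assoc matrix_mul_assoc)

lemma inner_congruence: "X \<bullet> (V ** Z ** hadj V) = (hadj V ** X ** V) \<bullet> Z"
  for V :: "complex^'n^'m"
  unfolding inner_commute[of X] matrix_inner_mult_right[of "V ** Z"] matrix_inner_mult_left[of V]
  by (simp add: matrix_mul_assoc inner_commute)

text \<open>A substitute for the least eigenvalue: \<open>x\<close> is recovered from A^H x by a
  bounded inverse, and \<sigma> is the inverse square of its bound.\<close>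

lemma gram_lower_bound:
  fixes A :: "complex^'n^'n"
  assumes "invertible A"
  obtains \<sigma> where "\<sigma> > 0" "\<And>x. \<sigma> * (norm x)\<^sup>2 \<le> x \<bullet> ((A ** hadj A) *v x)"
proof -
  obtain k where k: "k > 0" "\<And>y. norm (matrix_inv (hadj A) *v y) \<le> norm y * k"
    using bounded_linear.pos_bounded[OF mv.bounded_linear_right[of "matrix_inv (hadj A)"]] by auto
  have "inverse (k\<^sup>2) * (norm x)\<^sup>2 \<le> x \<bullet> ((A ** hadj A) *v x)" for x
  proof -
    have "norm x \<le> norm (hadj A *v x) * k"
      using k(2)[of "hadj A *v x"]
      by (simp add: matrix_vector_mul_assoc matrix_inv_mult invertible_hadj assms)
    then have "(norm x)\<^sup>2 \<le> (norm (hadj A *v x) * k)\<^sup>2" by (intro power_mono) auto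
    moreover have "x \<bullet> ((A ** hadj A) *v x) = (norm (hadj A *v x))\<^sup>2"
      using quadratic_form_congruence[of x A "mat 1"] by (simp add: power2_norm_eq_inner)
    ultimately show ?thesis using k(1) by (simp add: field_simps power_mult_distrib)
  qed
  with k(1) show ?thesis by (intro that[of "inverse (k\<^sup>2)"]) auto
qed

text \<open>Coercivity and Cauchy-Schwarz, applied to the solution of A x = y.\<close>

lemma norm_matrix_inv_mult_le:
  fixes A :: "complex^'n^'n"
  assumes "invertible A" "c > 0" "\<And>x. c * (norm x)\<^sup>2 \<le> x \<bullet> (A *v x)"
  shows "norm (matrix_inv A *v y) \<le> inverse c * norm y"
proof (cases "matrix_inv A *v y = 0")
  case True
  then show ?thesis using assms(2) by simp
next
  case False
  let ?x = "matrix_inv A *v y"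
  have "c * (norm ?x)\<^sup>2 \<le> ?x \<bullet> (A *v ?x)" by (rule assms(3))
  also have "A *v ?x = y" by (simp add: matrix_vector_mul_assoc matrix_inv_mult assms(1))
  also have "?x \<bullet> y \<le> norm ?x * norm y" by (rule norm_cauchy_schwarz)
  finally have "norm ?x * (c * norm ?x) \<le> norm ?x * norm y"
    by (simp add: power2_eq_square algebra_simps)
  then have "c * norm ?x \<le> norm y" using False by simp
  then show ?thesis using assms(2) by (simp add: field_simps)
qed

text \<open>Covariance of H r + z, where r has covariance \<open>R\<close> and the noise z has
  covariance N0 I.\<close>

definition rxcov :: "real \<Rightarrow> complex^'t^'t \<Rightarrow> complex^'t^'r \<Rightarrow> complex^'r^'r" where
  "rxcov N0 R H = H ** R ** hadj H + N0 *\<^sub>R mat 1"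

text \<open>
  Error covariance of the estimate G y of u = F s + x from y = H (s + x + n) + z, where s, x, n, z are
  uncorrelated with covariances S, Q, N and N0 I.
\<close>

definition mse :: "real \<Rightarrow> complex^'t^'t \<Rightarrow> complex^'t^'t \<Rightarrow> complex^'t^'t \<Rightarrow> complex^'t^'t \<Rightarrow>
    complex^'t^'r \<Rightarrow> complex^'r^'t \<Rightarrow> complex^'t^'t" where
  "mse N0 F S Q N H G = (F - G ** H) ** S ** hadj (F - G ** H)
     + (mat 1 - G ** H) ** Q ** hadj (mat 1 - G ** H)
     + (G ** H) ** N ** hadj (G ** H) + N0 *\<^sub>R (G ** hadj G)"

lemma rxcov_form:
  "y \<bullet> (rxcov N0 R H *v y) = (hadj H *v y) \<bullet> (R *v (hadj H *v y)) + N0 * (norm y)\<^sup>2"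
  by (simp add: rxcov_def mv.add_left mv.scaleR_left inner_add_right quadratic_form_congruence
      power2_norm_eq_inner)

lemma pd_rxcov:
  assumes "N0 > 0" "psd R"
  shows "pd (rxcov N0 R H)"
  unfolding pd_def
proof (intro conjI allI impI)
  show "hadj (rxcov N0 R H) = rxcov N0 R H"
    using assms(2) by (simp add: rxcov_def psd_def hadj_add hadj_mult hadj_scaleR matrix_mul_assoc)
  fix y :: "complex^'b" assume "y \<noteq> 0"
  then have "0 < N0 * (norm y)\<^sup>2" using assms(1) by simp
  moreover have "0 \<le> (hadj H *v y) \<bullet> (R *v (hadj H *v y))" using assms(2) by (simp add: psd_def)
  ultimately show "0 < y \<bullet> (rxcov N0 R H *v y)" unfolding rxcov_form by linarith
qed

text \<open>\<open>G0\<close> solves the normal equation G0 W = A H^H, with W the covariance of y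
  and A = F S + Q. This turns the cross terms of the square into those of the expanded error
  covariance.\<close>

lemma mse_complete_square:
  assumes herm: "hadj S = S" "hadj Q = Q" and W: "pd (rxcov N0 (S + Q + N) H)"
    and G0: "G0 = (F ** S + Q) ** hadj H ** matrix_inv (rxcov N0 (S + Q + N) H)"
  shows "mse N0 F S Q N H G
    = (F ** S ** hadj F + Q - G0 ** H ** hadj (F ** S + Q))
      + (G - G0) ** rxcov N0 (S + Q + N) H ** hadj (G - G0)"
proof -
  let ?W = "rxcov N0 (S + Q + N) H" and ?A = "F ** S + Q"
  note inv = pd_imp_invertible[OF W]
  have hA: "hadj ?A = S ** hadj F + Q" by (simp add: hadj_add hadj_mult herm)
  have G0W: "G0 ** ?W = ?A ** hadj H"
    by (simp add: G0 matrix_inv_mult[OF inv] flip: matrix_mul_assoc)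
  have "hadj (G0 ** ?W) = ?W ** hadj G0"
    using W by (simp add: hadj_mult pd_def)
  then have WG0: "?W ** hadj G0 = H ** hadj ?A" by (simp add: G0W hadj_mult)
  have "(G - G0) ** ?W ** hadj (G - G0)
      = G ** ?W ** hadj G - G ** (?W ** hadj G0) - (G0 ** ?W) ** hadj G + G0 ** (?W ** hadj G0)"
    by (simp add: hadj_diff mm.diff_left mm.diff_right matrix_mul_assoc)
  also have "\<dots> = G ** ?W ** hadj G - G ** (H ** hadj ?A) - (?A ** hadj H) ** hadj G
      + G0 ** (H ** hadj ?A)"
    unfolding WG0 G0W ..
  finally have "(F ** S ** hadj F + Q - G0 ** H ** hadj ?A) + (G - G0) ** ?W ** hadj (G - G0)
     = F ** S ** hadj F + Q + G ** ?W ** hadj G - G ** H ** hadj ?A - ?A ** hadj H ** hadj G"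
    by (simp add: matrix_mul_assoc)
  also have "\<dots> = mse N0 F S Q N H G"
    unfolding hA mse_def rxcov_def
    by (simp add: hadj_diff hadj_mult mm.add_left mm.add_right mm.diff_left mm.diff_right
        mm.scaleR_left mm.scaleR_right matrix_mul_assoc)
  finally show ?thesis by simp
qed

lemma hermitian_mse:
  assumes "hadj S = S" "hadj Q = Q" "hadj N = N"
  shows "hadj (mse N0 F S Q N H G) = mse N0 F S Q N H G"
  by (simp add: mse_def hadj_add hadj_mult hadj_scaleR assms matrix_mul_assoc)

lemma psd_dual_mse:
  assumes "psd_dual S" "psd_dual Q" "psd_dual N" "N0 \<ge> 0"
  shows "psd_dual (mse N0 F S Q N H G)"
  unfolding mse_def
  by (intro psd_dual_add psd_dual_congruence psd_dual_scaleR psd_dual_gram assms)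

text \<open>Only the contributions of \<open>Q\<close> and of the noise are kept. With y = G^H x and
  v = x - H^H y, both v and y cannot be small unless x is. The bound does not involve
  \<open>G\<close>, so an estimator depending on \<open>H\<close> may be inserted.\<close>

lemma mse_lower_bound:
  assumes psd: "psd S" "psd N" and N0: "N0 > 0" and \<sigma>: "\<sigma> > 0"
    and Q: "\<And>y. \<sigma> * (norm y)\<^sup>2 \<le> y \<bullet> (Q *v y)"
    and h: "h \<ge> 0" "\<And>y. norm (hadj H *v y) \<le> h * norm y"
  shows "inverse (inverse \<sigma> + h\<^sup>2 / N0) * (norm x)\<^sup>2 \<le> x \<bullet> (mse N0 F S Q N H G *v x)"
proof -
  define y where "y = hadj G *v x"
  define v where "v = x - hadj H *v y"
  let ?a = "norm v" and ?b = "norm y"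
  have v: "hadj (mat 1 - G ** H) *v x = v"
    by (simp add: v_def y_def hadj_diff hadj_mult mv.diff_left matrix_vector_mul_assoc)
  have "x \<bullet> (mse N0 F S Q N H G *v x)
     = (hadj (F - G ** H) *v x) \<bullet> (S *v (hadj (F - G ** H) *v x)) + v \<bullet> (Q *v v)
      + (hadj (G ** H) *v x) \<bullet> (N *v (hadj (G ** H) *v x)) + N0 * ?b\<^sup>2"
    using quadratic_form_congruence[of x G "mat 1"]
    by (simp add: mse_def mv.add_left mv.scaleR_left inner_add_right quadratic_form_congruence v
        y_def power2_norm_eq_inner)
  moreover have "\<sigma> * ?a\<^sup>2 \<le> v \<bullet> (Q *v v)" by (rule Q)
  ultimately have ge: "\<sigma> * ?a\<^sup>2 + N0 * ?b\<^sup>2 \<le> x \<bullet> (mse N0 F S Q N H G *v x)"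
    using psd by (simp add: psd_def add_increasing add_increasing2)
  have "norm x \<le> ?a + h * ?b"
    using norm_triangle_ineq[of v "hadj H *v y"] h(2)[of y] by (simp add: v_def)
  then have "(norm x)\<^sup>2 \<le> (?a + h * ?b)\<^sup>2" by (intro power_mono) auto
  \<comment> \<open>Weighted Cauchy-Schwarz with its defect written out as an explicit
    square.\<close>
  also have "(?a + h * ?b)\<^sup>2 + (N0 * ?b - h * \<sigma> * ?a)\<^sup>2 / (\<sigma> * N0)
      = (inverse \<sigma> + h\<^sup>2 / N0) * (\<sigma> * ?a\<^sup>2 + N0 * ?b\<^sup>2)"
    using N0 \<sigma> by (simp add: field_simps power2_eq_square)
  then have "(?a + h * ?b)\<^sup>2 \<le> (inverse \<sigma> + h\<^sup>2 / N0) * (\<sigma> * ?a\<^sup>2 + N0 * ?b\<^sup>2)"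
    using N0 \<sigma> by (smt (verit) divide_nonneg_pos mult_pos_pos zero_le_power2)
  also have "\<dots> \<le> (inverse \<sigma> + h\<^sup>2 / N0) * (x \<bullet> (mse N0 F S Q N H G *v x))"
    using ge N0 \<sigma> by (intro mult_left_mono) auto
  finally have "(norm x)\<^sup>2 \<le> (inverse \<sigma> + h\<^sup>2 / N0) * (x \<bullet> (mse N0 F S Q N H G *v x))" .
  moreover have "0 < inverse \<sigma> + h\<^sup>2 / N0" using N0 \<sigma> by (simp add: add_pos_nonneg)
  ultimately show ?thesis by (simp add: field_simps)
qed

text \<open>The bound is uniform in the unbounded matrix H: this is what makes T bounded.\<close>

lemma norm_channel_inverse_le:
  fixes H :: "complex^'t^'r"
  assumes "N0 > 0" "\<sigma> > 0" and R: "psd R" "\<And>y. \<sigma> * (norm y)\<^sup>2 \<le> y \<bullet> (R *v y)"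
  shows "norm (hadj H ** matrix_inv (rxcov N0 R H) ** H) \<le> real CARD('t) * inverse \<sigma>"
proof (rule norm_matrix_le)
  fix x
  let ?W = "rxcov N0 R H"
  note inv = pd_imp_invertible[OF pd_rxcov[OF assms(1) R(1), of H]]
  define z where "z = matrix_inv ?W *v (H *v x)"
  define v where "v = hadj H *v z"
  have v: "(hadj H ** matrix_inv ?W ** H) *v x = v"
    by (simp add: v_def z_def matrix_vector_mul_assoc matrix_mul_assoc)
  have "?W *v z = H *v x"
    by (simp add: z_def matrix_vector_mul_assoc matrix_mul_assoc matrix_inv_mult[OF inv])
  \<comment> \<open>Discarding the noise part of this form leaves \<sigma> |v|^2 \<le> x \<bullet>
    v, in which \<open>H\<close> no longer occurs.\<close>
  then have "z \<bullet> (?W *v z) = x \<bullet> v"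
    by (metis v_def inner_commute inner_matrix_vector_hadj)
  moreover have "\<sigma> * (norm v)\<^sup>2 \<le> z \<bullet> (?W *v z)"
    using R(2)[of v] assms(1) by (simp add: rxcov_form v_def add_increasing2)
  moreover have "x \<bullet> v \<le> norm x * norm v" by (rule norm_cauchy_schwarz)
  ultimately have "norm v * (\<sigma> * norm v) \<le> norm v * norm x"
    by (simp add: power2_eq_square algebra_simps)
  then have "v = 0 \<or> \<sigma> * norm v \<le> norm x"
    by (metis mult_le_cancel_left_pos zero_less_norm_iff)
  then show "norm ((hadj H ** matrix_inv ?W ** H) *v x) \<le> inverse \<sigma> * norm x"
    unfolding v using assms(2) by (auto simp: field_simps)
qed

section \<open>Integrability\<close>

text \<open>Continuity supplies measurability of functions of the channel, and the bound supplies
  integrability.\<close>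

definition bdd_cont :: "('a::real_normed_vector \<Rightarrow> 'b::real_normed_vector) \<Rightarrow> bool" where
  "bdd_cont f \<longleftrightarrow> continuous_on UNIV f \<and> (\<exists>c. \<forall>x. norm (f x) \<le> c)"

text \<open>The growth that remains integrable when only the second moment of the channel is finite.\<close>

definition quad_cont :: "('a::real_normed_vector \<Rightarrow> 'b::real_normed_vector) \<Rightarrow> bool" where
  "quad_cont f \<longleftrightarrow> continuous_on UNIV f \<and> (\<exists>c. \<forall>x. norm (f x) \<le> c * (1 + (norm x)\<^sup>2))"

lemma bdd_cont_const: "bdd_cont (\<lambda>x. c)"
  by (auto simp: bdd_cont_def)

lemma bdd_cont_diff: "bdd_cont f \<Longrightarrow> bdd_cont g \<Longrightarrow> bdd_cont (\<lambda>x. f x - g x)"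
  unfolding bdd_cont_def
  by (auto intro: continuous_on_diff) (meson norm_triangle_ineq4 add_mono order_trans)

lemma bdd_cont_hadj: "bdd_cont f \<Longrightarrow> bdd_cont (\<lambda>x. hadj (f x))"
  for f :: "_ \<Rightarrow> complex^'n^'m"
  unfolding bdd_cont_def
  by (auto simp: norm_hadj intro: bounded_linear.continuous_on[OF bounded_linear_hadj])

lemma bdd_cont_bilinear:
  assumes bil: "bounded_bilinear mul" and f: "bdd_cont f" and g: "bdd_cont g"
  shows "bdd_cont (\<lambda>x. mul (f x) (g x))"
proof -
  obtain a b where ab: "\<And>x. norm (f x) \<le> a" "\<And>x. norm (g x) \<le> b"
    using f g unfolding bdd_cont_def by metis
  obtain K where K: "K \<ge> 0" "\<And>u v. norm (mul u v) \<le> norm u * norm v * K"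
    using bounded_bilinear.nonneg_bounded[OF bil] by blast
  have "norm (mul (f x) (g x)) \<le> a * b * K" for x
  proof -
    have "norm (f x) * norm (g x) \<le> a * b"
      using ab[of x] by (intro mult_mono order_trans[OF norm_ge_zero ab(1)]) auto
    then show ?thesis using K(2)[of "f x" "g x"] K(1) by (meson mult_right_mono order_trans)
  qed
  with f g show ?thesis
    unfolding bdd_cont_def by (blast intro: bounded_bilinear.continuous_on[OF bil])
qed

text \<open>Only one factor may grow: a product of two quadratically growing factors would call for
  fourth moments of the channel.\<close>

lemma quad_cont_bilinear:
  assumes bil: "bounded_bilinear mul" and f: "quad_cont f" and g: "bdd_cont g"
  shows "quad_cont (\<lambda>x. mul (f x) (g x))"
proof -
  obtain a b where ab: "\<And>x. norm (f x) \<le> a * (1 + (norm x)\<^sup>2)" "\<And>x. norm (g x) \<le> b"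
    using f g unfolding bdd_cont_def quad_cont_def by metis
  obtain K where K: "K \<ge> 0" "\<And>u v. norm (mul u v) \<le> norm u * norm v * K"
    using bounded_bilinear.nonneg_bounded[OF bil] by blast
  have "norm (mul (f x) (g x)) \<le> (a * b * K) * (1 + (norm x)\<^sup>2)" for x
  proof -
    have "norm (f x) * norm (g x) \<le> a * (1 + (norm x)\<^sup>2) * b"
      using ab(1)[of x] ab(2)[of x] by (intro mult_mono order_trans[OF norm_ge_zero ab(1)]) auto
    then have "norm (f x) * norm (g x) * K \<le> a * (1 + (norm x)\<^sup>2) * b * K"
      using K(1) by (rule mult_right_mono)
    then show ?thesis using K(2)[of "f x" "g x"] by (simp add: mult_ac)
  qed
  with f g show ?thesis
    unfolding bdd_cont_def quad_cont_def by (blast intro: bounded_bilinear.continuous_on[OF bil])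
qed

lemmas quad_cont_mult_right = quad_cont_bilinear[OF bounded_bilinear_matrix_mult]
lemmas quad_cont_mult_left =
  quad_cont_bilinear[OF bounded_bilinear.flip[OF bounded_bilinear_matrix_mult]]
lemmas quad_cont_inner = quad_cont_bilinear[OF bounded_bilinear_inner]
lemmas bdd_cont_mult = bdd_cont_bilinear[OF bounded_bilinear_matrix_mult]
lemmas bdd_cont_inner = bdd_cont_bilinear[OF bounded_bilinear_inner]

lemma quad_cont_add:
  assumes "quad_cont f" "quad_cont g"
  shows "quad_cont (\<lambda>x. f x + g x)"
proof -
  obtain a b where ab: "\<And>x. norm (f x) \<le> a * (1 + (norm x)\<^sup>2)" "\<And>x. norm (g x) \<le> b * (1 + (norm x)\<^sup>2)"
    using assms unfolding quad_cont_def by metis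
  have "norm (f x + g x) \<le> (a + b) * (1 + (norm x)\<^sup>2)" for x
    using norm_triangle_ineq[of "f x" "g x"] ab[of x] unfolding distrib_right by linarith
  with assms show ?thesis unfolding quad_cont_def by (blast intro: continuous_on_add)
qed

lemma quad_cont_minus: "quad_cont f \<Longrightarrow> quad_cont (\<lambda>x. - f x)"
  unfolding quad_cont_def by (auto intro: continuous_on_minus)

lemma quad_cont_diff: "quad_cont f \<Longrightarrow> quad_cont g \<Longrightarrow> quad_cont (\<lambda>x. f x - g x)"
  using quad_cont_add[of f "\<lambda>x. - g x"] quad_cont_minus[of g] by simp

lemma bdd_cont_imp_quad_cont: "bdd_cont f \<Longrightarrow> quad_cont f"
proof -
  assume f: "bdd_cont f"
  then obtain c where c: "\<And>x. norm (f x) \<le> c" unfolding bdd_cont_def by metis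
  have "norm (f x) \<le> c * (1 + (norm x)\<^sup>2)" for x
  proof -
    have "0 \<le> c" using c[of x] norm_ge_zero[of "f x"] by linarith
    then have "c * 1 \<le> c * (1 + (norm x)\<^sup>2)" by (intro mult_left_mono) auto
    with c[of x] show ?thesis by linarith
  qed
  with f show "quad_cont f" unfolding quad_cont_def bdd_cont_def by blast
qed

lemma quad_cont_between:
  fixes f :: "_ \<Rightarrow> real"
  assumes "continuous_on UNIV f" "quad_cont g" "quad_cont h" "\<And>x. g x \<le> f x" "\<And>x. f x \<le> h x"
  shows "quad_cont f"
proof -
  obtain a b where ab: "\<And>x. norm (g x) \<le> a * (1 + (norm x)\<^sup>2)" "\<And>x. norm (h x) \<le> b * (1 + (norm x)\<^sup>2)"
    using assms(2,3) unfolding quad_cont_def by metis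
  have "norm (f x) \<le> (a + b) * (1 + (norm x)\<^sup>2)" for x
    using assms(4,5)[of x] ab[of x] unfolding distrib_right real_norm_def by linarith
  with assms(1) show ?thesis unfolding quad_cont_def by blast
qed

text \<open>The trace in the moment condition is the squared norm, so a multiple of 1 + |X|^2 is an
  integrable majorant.\<close>

lemma (in prob_space) integrable_quad_cont:
  fixes f :: "complex^'t^'r \<Rightarrow> 'b::{second_countable_topology, banach}"
  assumes f: "quad_cont f" and X: "X \<in> borel_measurable M"
    and fin: "(\<integral>\<^sup>+\<omega>. ennreal (Re (trace (X \<omega> ** hadj (X \<omega>)))) \<partial>M) < \<infinity>"
  shows "integrable M (\<lambda>\<omega>. f (X \<omega>))"
proof -
  obtain c where c: "\<And>x. norm (f x) \<le> c * (1 + (norm x)\<^sup>2)" and "continuous_on UNIV f"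
    using f unfolding quad_cont_def by metis
  then have meas: "(\<lambda>\<omega>. f (X \<omega>)) \<in> borel_measurable M"
    using X borel_measurable_continuous_onI measurable_compose by blast
  have "integrable M (\<lambda>\<omega>. (norm (X \<omega>))\<^sup>2)"
    using fin X by (intro integrableI_nonneg) (auto simp: Re_trace_gram)
  then have "integrable M (\<lambda>\<omega>. c * (1 + (norm (X \<omega>))\<^sup>2))" by auto
  then show ?thesis
    by (rule Bochner_Integration.integrable_bound[OF _ meas])
      (auto intro!: order_trans[OF c] abs_ge_self)
qed

section \<open>Covariances of a design and the MMSE estimator\<close>

lemma psd_gram: "psd (A ** hadj A)" for A :: "complex^'n^'m"
  unfolding psd_def
  using quadratic_form_congruence[of _ A "mat 1"] by (auto simp: hadj_mult)

lemma psd_add: "psd A \<Longrightarrow> psd B \<Longrightarrow> psd (A + B)"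
  by (auto simp: psd_def hadj_add mv.add_left inner_add_right)

lemma psd_sum: "(\<And>i. i \<in> I \<Longrightarrow> psd (f i)) \<Longrightarrow> psd (\<Sum>i\<in>I. f i)"
  by (auto simp: psd_def hadj_sum mv.sum_left inner_sum_right intro!: sum_nonneg)

text \<open>Covariance of the signals of later receivers, which act as noise. It is separated from
  \<open>SigZ\<close> so that it can be merged into the covariance of the channel input.\<close>

definition SigN :: "nat \<Rightarrow> (nat \<Rightarrow> complex^'t^'t) \<Rightarrow> nat \<Rightarrow> complex^'t^'t" where
  "SigN L Sig l = (\<Sum>t\<in>{l+1..L}. Sig t)"

text \<open>The MMSE estimator \<open>G0\<close> of the introduction, as a function of the
  channel.\<close>

definition estimator :: "nat \<Rightarrow> real \<Rightarrow> (nat \<Rightarrow> complex^'t^'t) \<Rightarrow> (nat \<Rightarrow> complex^'t^'t) \<Rightarrow>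
    nat \<Rightarrow> complex^'t^'r \<Rightarrow> complex^'r^'t" where
  "estimator L N0 F Sig l H = Amat F Sig l ** hadj H **
     matrix_inv (rxcov N0 (SigS Sig l + Sig l + SigN L Sig l) H)"

lemma rxcov_eq:
  fixes H :: "complex^'t^'r"
  shows "H ** Bmat Sig l ** hadj H + SigZ L N0 Sig l H = rxcov N0 (SigS Sig l + Sig l + SigN L Sig l) H"
proof -
  have "(mat (complex_of_real N0) :: complex^'r^'r) = N0 *\<^sub>R mat 1"
    by (simp add: mat_def vec_eq_iff) (simp add: scaleR_conv_of_real)
  then show ?thesis
    by (simp add: rxcov_def SigZ_def Bmat_def SigN_def mm.add_left mm.add_right add.assoc)
qed

lemma continuous_on_rxcov: "continuous_on S (\<lambda>H :: complex^'t^'r. rxcov N0 R H)"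
  unfolding rxcov_def
  by (intro continuous_on_add mm.continuous_on continuous_on_const continuous_on_id
      bounded_linear.continuous_on[OF bounded_linear_hadj])

lemma Tmat_eq: "Tmat L N0 F Sig l H = estimator L N0 F Sig l H ** H"
  by (simp add: Tmat_def estimator_def rxcov_eq)

lemma SigUY_eq:
  "SigUY L N0 F Sig l H = Cmat F Sig l - estimator L N0 F Sig l H ** H ** hadj (Amat F Sig l)"
  by (simp add: SigUY_def estimator_def rxcov_eq)

lemma psd_SigOf: "psd (SigOf P l)" "psd (SigS (SigOf P) l)" "psd (SigN L (SigOf P) l)"
  unfolding SigOf_def SigS_def SigN_def by (auto intro!: psd_sum psd_gram)

lemma psd_dual_SigOf:
  "psd_dual (SigOf P l)" "psd_dual (SigS (SigOf P) l)" "psd_dual (SigN L (SigOf P) l)"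
  unfolding SigOf_def SigS_def SigN_def by (auto intro!: psd_dual_sum psd_dual_gram)

lemma hermitian_SigOf:
  "hadj (SigOf P l) = SigOf P l" "hadj (SigS (SigOf P) l) = SigS (SigOf P) l"
  "hadj (SigN L (SigOf P) l) = SigN L (SigOf P) l"
  using psd_SigOf unfolding psd_def by blast+

context
  fixes P :: "nat \<Rightarrow> complex^'t^'t" and N0 :: real
  assumes N0: "N0 > 0"
begin

section \<open>Positivity and growth of the conditional covariance\<close>

lemma pd_rxcov_SigOf:
  "pd (rxcov N0 (SigS (SigOf P) l + SigOf P l + SigN L (SigOf P) l) H)"
  by (intro pd_rxcov N0 psd_add psd_SigOf)

lemma mse_eq_SigUY:
  "mse N0 (F l) (SigS (SigOf P) l) (SigOf P l) (SigN L (SigOf P) l) H G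
   = SigUY L N0 F (SigOf P) l H
     + (G - estimator L N0 F (SigOf P) l H)
       ** rxcov N0 (SigS (SigOf P) l + SigOf P l + SigN L (SigOf P) l) H
       ** hadj (G - estimator L N0 F (SigOf P) l H)"
  unfolding SigUY_eq Cmat_def Amat_def
  by (rule mse_complete_square[OF hermitian_SigOf(2,1) pd_rxcov_SigOf])
    (simp add: estimator_def Amat_def)

text \<open>At the MMSE estimator the square vanishes. \<open>SigUY\<close>, defined as a
  difference, thereby becomes a sum of congruences whose positivity is evident.\<close>

lemma SigUY_eq_mse:
  "SigUY L N0 F (SigOf P) l H
   = mse N0 (F l) (SigS (SigOf P) l) (SigOf P l) (SigN L (SigOf P) l) H (estimator L N0 F (SigOf P) l H)"
  by (simp add: mse_eq_SigUY)

lemma psd_dual_SigUY: "psd_dual (SigUY L N0 F (SigOf P) l H)"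
  unfolding SigUY_eq_mse using N0 by (intro psd_dual_mse psd_dual_SigOf) simp

lemma hermitian_SigUY: "hadj (SigUY L N0 F (SigOf P) l H) = SigUY L N0 F (SigOf P) l H"
  unfolding SigUY_eq_mse by (intro hermitian_mse hermitian_SigOf)

lemma continuous_on_estimator:
  "continuous_on UNIV (\<lambda>H :: complex^'t^'r. estimator L N0 F (SigOf P) l H)"
  unfolding estimator_def
  by (intro mm.continuous_on continuous_on_matrix_inv continuous_on_const continuous_on_id
      bounded_linear.continuous_on[OF bounded_linear_hadj] pd_imp_invertible pd_rxcov_SigOf
      continuous_on_rxcov)

context
  fixes l :: nat
  assumes inv: "invertible (P l)"
begin

text \<open>Invertibility of \<open>P l\<close> makes the signal covariance coercive, and
  \<open>mse_lower_bound\<close> carries this over to \<open>SigUY\<close>. The constant decays only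
  like the inverse of 1 + |H|^2.\<close>

lemma SigUY_lower_bound:
  obtains c where "\<And>H :: complex^'t^'r. 0 < c * (1 + (norm H)\<^sup>2)"
    "\<And>(H :: complex^'t^'r) x. inverse (c * (1 + (norm H)\<^sup>2)) * (norm x)\<^sup>2
      \<le> x \<bullet> (SigUY L N0 F (SigOf P) l H *v x)"
proof -
  obtain \<sigma> where \<sigma>: "\<sigma> > 0" "\<And>x. \<sigma> * (norm x)\<^sup>2 \<le> x \<bullet> (SigOf P l *v x)"
    using gram_lower_bound[OF inv] unfolding SigOf_def by metis
  obtain k where k: "k \<ge> 0" "\<And>(B :: complex^'r^'t) y. norm (B *v y) \<le> norm B * norm y * k"
    using mv.nonneg_bounded by blast
  \<comment> \<open>\<open>c\<close> dominates both coefficients, that of 1 and that of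
    |H|^2.\<close>
  define c where "c = inverse \<sigma> + k\<^sup>2 / N0"
  have "c > 0" using \<sigma>(1) N0 by (simp add: c_def add_pos_nonneg)
  then have pos: "0 < c * (1 + (norm H)\<^sup>2)" for H :: "complex^'t^'r"
    by (intro mult_pos_pos) (auto intro: add_pos_nonneg)
  have "inverse (c * (1 + (norm H)\<^sup>2)) * (norm x)\<^sup>2
      \<le> x \<bullet> (SigUY L N0 F (SigOf P) l H *v x)" for H :: "complex^'t^'r" and x
  proof -
    let ?q = "inverse \<sigma> + (k * norm H)\<^sup>2 / N0"
    have "?q \<le> c * (1 + (norm H)\<^sup>2)"
      using \<sigma>(1) N0 by (simp add: c_def algebra_simps power_mult_distrib add_divide_distrib)
    moreover have "?q > 0" using \<sigma>(1) N0 by (simp add: add_pos_nonneg)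
    ultimately have "inverse (c * (1 + (norm H)\<^sup>2)) \<le> inverse ?q"
      by (intro le_imp_inverse_le)
    then have "inverse (c * (1 + (norm H)\<^sup>2)) * (norm x)\<^sup>2 \<le> inverse ?q * (norm x)\<^sup>2"
      by (intro mult_right_mono) auto
    also have "\<dots> \<le> x \<bullet> (SigUY L N0 F (SigOf P) l H *v x)"
      unfolding SigUY_eq_mse
    proof (rule mse_lower_bound)
      show "norm (hadj H *v y) \<le> k * norm H * norm y" for y
        using k(2)[of "hadj H" y] by (simp add: norm_hadj mult_ac)
    qed (use psd_SigOf N0 \<sigma> k in auto)
    finally show ?thesis .
  qed
  with pos show ?thesis by (rule that)
qed

lemma pd_SigUY: "pd (SigUY L N0 F (SigOf P) l (H :: complex^'t^'r))"
  unfolding pd_def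
proof (intro conjI allI impI hermitian_SigUY)
  obtain c where c: "\<And>H :: complex^'t^'r. 0 < c * (1 + (norm H)\<^sup>2)"
    "\<And>(H :: complex^'t^'r) x. inverse (c * (1 + (norm H)\<^sup>2)) * (norm x)\<^sup>2
      \<le> x \<bullet> (SigUY L N0 F (SigOf P) l H *v x)"
    using SigUY_lower_bound by metis
  fix x :: "complex^'t" assume "x \<noteq> 0"
  then have "0 < inverse (c * (1 + (norm H)\<^sup>2)) * (norm x)\<^sup>2"
    by (intro mult_pos_pos positive_imp_inverse_positive c(1)) auto
  with c(2)[of H x] show "0 < x \<bullet> (SigUY L N0 F (SigOf P) l H *v x)" by linarith
qed

text \<open>\<open>Tmat\<close> is the constant matrix \<open>Amat\<close> times \<open>?J\<close>,
  which \<open>norm_channel_inverse_le\<close> bounds uniformly. The coercivity of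
  \<open>SigOf P l\<close> passes to \<open>?R\<close> because the other summands are positive
  semidefinite.\<close>

lemma bdd_cont_Tmat:
  "bdd_cont (\<lambda>H :: complex^'t^'r. Tmat L N0 F (SigOf P) l H)"
proof -
  let ?R = "SigS (SigOf P) l + SigOf P l + SigN L (SigOf P) l"
  let ?J = "\<lambda>H :: complex^'t^'r. hadj H ** matrix_inv (rxcov N0 ?R H) ** H"
  obtain \<sigma> where \<sigma>: "\<sigma> > 0" "\<And>x. \<sigma> * (norm x)\<^sup>2 \<le> x \<bullet> (SigOf P l *v x)"
    using gram_lower_bound[OF inv] unfolding SigOf_def by metis
  have "\<sigma> * (norm x)\<^sup>2 \<le> x \<bullet> (?R *v x)" for x
    using \<sigma>(2)[of x] psd_SigOf(2)[of P l] psd_SigOf(3)[of L P l] unfolding psd_def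
    by (simp add: mv.add_left inner_add_right add_increasing add_increasing2)
  then have J: "norm (?J H) \<le> real CARD('t) * inverse \<sigma>" for H
    using N0 \<sigma>(1) by (intro norm_channel_inverse_le psd_add psd_SigOf)
  obtain k where k: "k \<ge> 0"
    "\<And>(B :: complex^'t^'t) (C :: complex^'t^'t). norm (B ** C) \<le> norm B * norm C * k"
    using mm.nonneg_bounded by blast
  have "norm (Tmat L N0 F (SigOf P) l H)
      \<le> norm (Amat F (SigOf P) l) * (real CARD('t) * inverse \<sigma>) * k" for H :: "complex^'t^'r"
  proof -
    have "norm (Tmat L N0 F (SigOf P) l H) = norm (Amat F (SigOf P) l ** ?J H)"
      by (simp add: Tmat_eq estimator_def matrix_mul_assoc)
    also have "\<dots> \<le> norm (Amat F (SigOf P) l) * norm (?J H) * k" by (rule k(2))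
    also have "\<dots> \<le> norm (Amat F (SigOf P) l) * (real CARD('t) * inverse \<sigma>) * k"
      by (intro mult_right_mono mult_left_mono J k(1) norm_ge_zero)
    finally show ?thesis .
  qed
  moreover have "continuous_on UNIV (\<lambda>H :: complex^'t^'r. Tmat L N0 F (SigOf P) l H)"
    unfolding Tmat_eq by (intro mm.continuous_on continuous_on_estimator continuous_on_id)
  ultimately show ?thesis unfolding bdd_cont_def by blast
qed

text \<open>\<open>SigUY\<close> is affine in \<open>Tmat\<close>, so it inherits
  boundedness.\<close>

lemma bdd_cont_SigUY: "bdd_cont (\<lambda>H :: complex^'t^'r. SigUY L N0 F (SigOf P) l H)"
  unfolding SigUY_eq Tmat_eq[symmetric]
  by (intro bdd_cont_diff bdd_cont_mult bdd_cont_const bdd_cont_Tmat)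

lemma continuous_on_SigUY:
  "continuous_on UNIV (\<lambda>H :: complex^'t^'r. SigUY L N0 F (SigOf P) l H)"
  using bdd_cont_SigUY[where 'r = 'r] unfolding bdd_cont_def by blast

lemma quad_cont_inv_SigUY:
  "quad_cont (\<lambda>H :: complex^'t^'r. matrix_inv (SigUY L N0 F (SigOf P) l H))"
proof -
  obtain c where c: "\<And>H :: complex^'t^'r. 0 < c * (1 + (norm H)\<^sup>2)"
    "\<And>(H :: complex^'t^'r) x. inverse (c * (1 + (norm H)\<^sup>2)) * (norm x)\<^sup>2
      \<le> x \<bullet> (SigUY L N0 F (SigOf P) l H *v x)"
    using SigUY_lower_bound by metis
  have "norm (matrix_inv (SigUY L N0 F (SigOf P) l H))
      \<le> (real CARD('t) * c) * (1 + (norm H)\<^sup>2)" for H :: "complex^'t^'r"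
  proof -
    have "norm (matrix_inv (SigUY L N0 F (SigOf P) l H) *v y) \<le> c * (1 + (norm H)\<^sup>2) * norm y" for y
      using norm_matrix_inv_mult_le[OF pd_imp_invertible[OF pd_SigUY]
          positive_imp_inverse_positive[OF c(1)] c(2), of H y]
      by simp
    from norm_matrix_le[OF this] show ?thesis by (simp add: mult.assoc)
  qed
  moreover have "continuous_on UNIV (\<lambda>H :: complex^'t^'r. matrix_inv (SigUY L N0 F (SigOf P) l H))"
    by (intro continuous_on_matrix_inv pd_imp_invertible pd_SigUY continuous_on_SigUY)
  ultimately show ?thesis unfolding quad_cont_def by blast
qed

text \<open>Log det lies between two tangent bounds: the lower one grows at most like the inverse of
  \<open>SigUY\<close>, the upper one is bounded.\<close>

lemma quad_cont_ln_det_SigUY: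
  "quad_cont (\<lambda>H :: complex^'t^'r. ln (Re (det (SigUY L N0 F (SigOf P) l H))))"
proof (rule quad_cont_between)
  show "continuous_on UNIV (\<lambda>H :: complex^'t^'r. ln (Re (det (SigUY L N0 F (SigOf P) l H))))"
    by (intro continuous_intros ballI less_imp_neq[symmetric] det_pd_pos pd_SigUY
        continuous_on_SigUY)
  show "- (matrix_inv (SigUY L N0 F (SigOf P) l H) \<bullet> (mat 1 - SigUY L N0 F (SigOf P) l H))
      \<le> ln (Re (det (SigUY L N0 F (SigOf P) l H)))" for H :: "complex^'t^'r"
    by (rule ln_det_ge_trace_inv[OF pd_SigUY psd_dual_SigUY])
  show "quad_cont (\<lambda>H :: complex^'t^'r.
      - (matrix_inv (SigUY L N0 F (SigOf P) l H) \<bullet> (mat 1 - SigUY L N0 F (SigOf P) l H)))"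
    by (intro quad_cont_minus quad_cont_inner quad_cont_inv_SigUY bdd_cont_diff bdd_cont_const
        bdd_cont_SigUY)
  show "ln (Re (det (SigUY L N0 F (SigOf P) l H))) \<le> mat 1 \<bullet> (SigUY L N0 F (SigOf P) l H - mat 1)"
    for H :: "complex^'t^'r"
    by (rule ln_det_le_trace[OF pd_SigUY])
  show "quad_cont (\<lambda>H :: complex^'t^'r. mat 1 \<bullet> (SigUY L N0 F (SigOf P) l H - mat 1))"
    by (intro bdd_cont_imp_quad_cont bdd_cont_inner bdd_cont_diff bdd_cont_const bdd_cont_SigUY)
qed

lemma quad_cont_congruence:
  fixes V :: "complex^'t^'r \<Rightarrow> complex^'t^'t"
  assumes "bdd_cont V"
  shows "quad_cont (\<lambda>H. hadj (V H) ** matrix_inv (SigUY L N0 F (SigOf P) l H) ** V H)"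
  by (rule quad_cont_mult_right[OF quad_cont_mult_left[OF quad_cont_inv_SigUY
        bdd_cont_hadj[OF assms]] assms])

end

end

section \<open>The surrogate of the weighted sum-rate\<close>

text \<open>tr (SigUY^-1 (mse'(G0) - mse(G0))); the noise term of the two error covariances cancels.\<close>

definition mse_gap :: "nat \<Rightarrow> real \<Rightarrow> (nat \<Rightarrow> complex^'t^'t) \<Rightarrow> (nat \<Rightarrow> complex^'t^'t) \<Rightarrow>
    (nat \<Rightarrow> complex^'t^'t) \<Rightarrow> (nat \<Rightarrow> complex^'t^'t) \<Rightarrow> nat \<Rightarrow> complex^'t^'r \<Rightarrow> real" where
  "mse_gap L N0 F P F' P' l H =
    (let S = matrix_inv (SigUY L N0 F (SigOf P) l H); T = Tmat L N0 F (SigOf P) l H in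
      (hadj (F' l - T) ** S ** (F' l - T)) \<bullet> SigS (SigOf P') l
      - (hadj (F l - T) ** S ** (F l - T)) \<bullet> SigS (SigOf P) l
      + (hadj (mat 1 - T) ** S ** (mat 1 - T)) \<bullet> (SigOf P' l - SigOf P l)
      + (hadj T ** S ** T) \<bullet> (SigN L (SigOf P') l - SigN L (SigOf P) l))"

lemma quad_cont_mse_gap:
  fixes P P' F F' :: "nat \<Rightarrow> complex^'t^'t"
  assumes "N0 > 0" "invertible (P l)"
  shows "quad_cont (\<lambda>H :: complex^'t^'r. mse_gap L N0 F P F' P' l H)"
  unfolding mse_gap_def Let_def
  by (intro quad_cont_add quad_cont_diff quad_cont_inner bdd_cont_const bdd_cont_diff
      quad_cont_congruence bdd_cont_Tmat assms)

text \<open>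
  The estimator that is optimal for (F, P) is merely admissible for (F', P'), and the logarithm of
  the determinant lies below its tangent.
\<close>

lemma ln_det_SigUY_le:
  fixes P P' F F' :: "nat \<Rightarrow> complex^'t^'t" and H :: "complex^'t^'r"
  assumes N0: "N0 > 0" and inv: "invertible (P l)" "invertible (P' l)"
  shows "ln (Re (det (SigUY L N0 F' (SigOf P') l H)))
    \<le> ln (Re (det (SigUY L N0 F (SigOf P) l H))) + mse_gap L N0 F P F' P' l H"
proof -
  let ?X = "SigUY L N0 F (SigOf P) l H" and ?X' = "SigUY L N0 F' (SigOf P') l H"
  let ?S = "matrix_inv ?X"
  let ?G = "estimator L N0 F (SigOf P) l H" and ?G' = "estimator L N0 F' (SigOf P') l H"
  let ?W' = "rxcov N0 (SigS (SigOf P') l + SigOf P' l + SigN L (SigOf P') l) H"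
  let ?Q = "mse N0 (F l) (SigS (SigOf P) l) (SigOf P l) (SigN L (SigOf P) l) H ?G"
  let ?Q' = "mse N0 (F' l) (SigS (SigOf P') l) (SigOf P' l) (SigN L (SigOf P') l) H ?G"
  have pdX: "pd ?X" by (rule pd_SigUY[where P = P and l = l, OF N0 inv(1)])
  have "ln (Re (det ?X')) \<le> ln (Re (det ?X)) + ?S \<bullet> (?X' - ?X)"
    by (intro ln_det_le_tangent pd_SigUY psd_dual_SigUY N0 inv)
  \<comment> \<open>The excess error of \<open>?G\<close> at the new design is a congruence of
    \<open>?W'\<close>, hence pairs nonnegatively with \<open>?S\<close>.\<close>
  moreover have "?S \<bullet> ?X' \<le> ?S \<bullet> ?Q'"
  proof -
    have "psd_dual ?W'"
      unfolding rxcov_def using N0 psd_dual_gram[of "mat 1"]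
      by (intro psd_dual_add psd_dual_congruence psd_dual_scaleR psd_dual_SigOf) auto
    then have "psd_dual ((?G - ?G') ** ?W' ** hadj (?G - ?G'))"
      by (rule psd_dual_congruence)
    then have "0 \<le> ?S \<bullet> ((?G - ?G') ** ?W' ** hadj (?G - ?G'))"
      using pd_imp_psd[OF pd_matrix_inv[OF pdX]] by (simp add: psd_dual_def inner_commute)
    then show ?thesis
      unfolding mse_eq_SigUY[OF N0] by (simp add: inner_add_right)
  qed
  moreover have "?S \<bullet> (?Q' - ?Q) = mse_gap L N0 F P F' P' l H"
    unfolding mse_def mse_gap_def Let_def Tmat_eq
    by (simp add: inner_add_right inner_diff_right inner_congruence)
  moreover have "?X = ?Q" by (rule SigUY_eq_mse[OF N0])
  ultimately show ?thesis by (simp add: inner_diff_right)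
qed

text \<open>Integrating \<open>ln_det_SigUY_le\<close> gives a minorant of the rate that agrees with
  it at (F, P).\<close>

lemma (in prob_space) rate_ge:
  fixes P P' F F' :: "nat \<Rightarrow> complex^'t^'t" and H :: "nat \<Rightarrow> 'a \<Rightarrow> complex^'t^'r"
  assumes N0: "N0 > 0" and inv: "invertible (P l)" "invertible (P' l)"
    and H: "H l \<in> borel_measurable M"
      "(\<integral>\<^sup>+\<omega>. ennreal (Re (trace (H l \<omega> ** hadj (H l \<omega>)))) \<partial>M) < \<infinity>"
  shows "rate M H L N0 F P l + (ln (Re (det (SigOf P' l))) - ln (Re (det (SigOf P l)))
      - (\<integral>\<omega>. mse_gap L N0 F P F' P' l (H l \<omega>) \<partial>M)) / ln 2
    \<le> rate M H L N0 F' P' l"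
proof -
  note int = integrable_quad_cont[OF _ H]
  note i = int[OF quad_cont_ln_det_SigUY[where P = P and l = l, OF N0 inv(1)]] int[OF quad_cont_mse_gap[where P = P and l = l, OF N0 inv(1)]]
    int[OF quad_cont_ln_det_SigUY[where P = P' and l = l, OF N0 inv(2)]]
  have "(\<integral>\<omega>. ln (Re (det (SigUY L N0 F' (SigOf P') l (H l \<omega>)))) \<partial>M)
      \<le> (\<integral>\<omega>. ln (Re (det (SigUY L N0 F (SigOf P) l (H l \<omega>))))
            + mse_gap L N0 F P F' P' l (H l \<omega>) \<partial>M)"
    by (intro integral_mono Bochner_Integration.integrable_add i ln_det_SigUY_le N0 inv)
  also have "\<dots> = (\<integral>\<omega>. ln (Re (det (SigUY L N0 F (SigOf P) l (H l \<omega>)))) \<partial>M)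
      + (\<integral>\<omega>. mse_gap L N0 F P F' P' l (H l \<omega>) \<partial>M)"
    by (intro Bochner_Integration.integral_add i)
  finally have "(ln (Re (det (SigOf P l))) - (\<integral>\<omega>. ln (Re (det (SigUY L N0 F (SigOf P) l (H l \<omega>)))) \<partial>M)
     + (ln (Re (det (SigOf P' l))) - ln (Re (det (SigOf P l)))
      - (\<integral>\<omega>. mse_gap L N0 F P F' P' l (H l \<omega>) \<partial>M))) / ln 2
     \<le> (ln (Re (det (SigOf P' l)))
        - (\<integral>\<omega>. ln (Re (det (SigUY L N0 F' (SigOf P') l (H l \<omega>)))) \<partial>M)) / ln 2"
    by (intro divide_right_mono) auto
  then show ?thesis
    unfolding rate_def log2det_def log_def by (simp add: add_divide_distrib diff_divide_distrib)
qed

text \<open>The weighted minorants lie below the sum-rate of (F', P'), which optimality bounds by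
  that of (F, P); so the minorant cannot increase.\<close>

lemma optimal_design_surrogate:
  fixes P P' F F' :: "nat \<Rightarrow> complex^'t^'t" and H :: "nat \<Rightarrow> 'w \<Rightarrow> complex^'t^'r"
  assumes M: "prob_space M" and N0: "N0 > 0" and \<mu>: "\<forall>l\<in>{1..L}. \<mu> l \<ge> 0"
    and H: "\<forall>l\<in>{1..L}. H l \<in> borel_measurable M"
      "\<forall>l\<in>{1..L}. (\<integral>\<^sup>+\<omega>. ennreal (Re (trace (H l \<omega> ** hadj (H l \<omega>)))) \<partial>M) < \<infinity>"
    and opt: "optimal_design M H L N0 Pw \<mu> F P" and feas: "feasible L Pw P'"
  shows "(\<Sum>l\<in>{1..L}. \<mu> l * (ln (Re (det (SigOf P' l))) - ln (Re (det (SigOf P l)))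
      - (\<integral>\<omega>. mse_gap L N0 F P F' P' l (H l \<omega>) \<partial>M))) \<le> 0"
proof -
  let ?g = "\<lambda>l. ln (Re (det (SigOf P' l))) - ln (Re (det (SigOf P l)))
      - (\<integral>\<omega>. mse_gap L N0 F P F' P' l (H l \<omega>) \<partial>M)"
  have inv: "invertible (P l)" "invertible (P' l)" if "l \<in> {1..L}" for l
    using opt feas that by (auto simp: optimal_design_def feasible_def)
  have "(\<Sum>l\<in>{1..L}. \<mu> l * (rate M H L N0 F P l + ?g l / ln 2))
      \<le> (\<Sum>l\<in>{1..L}. \<mu> l * rate M H L N0 F' P' l)"
    using \<mu> H inv by (intro sum_mono mult_left_mono prob_space.rate_ge[OF M N0]) auto
  also have "\<dots> \<le> (\<Sum>l\<in>{1..L}. \<mu> l * rate M H L N0 F P l)"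
    using opt feas by (simp add: optimal_design_def wsum_rate_def)
  finally have "(\<Sum>l\<in>{1..L}. \<mu> l * ?g l) / ln 2 \<le> 0"
    by (simp add: distrib_left sum.distrib sum_divide_distrib)
  then show ?thesis by (simp add: divide_le_0_iff)
qed

section \<open>Stationarity\<close>

lemma linear_coefficient_zero:
  fixes b c :: real
  assumes "\<And>e. 0 \<le> b * e + c * e\<^sup>2"
  shows "b = 0"
proof (rule ccontr)
  assume "b \<noteq> 0"
  \<comment> \<open>Any \<open>d\<close> above both 0 and \<open>c\<close> would do; -b/d is then a
    point where the polynomial is negative.\<close>
  define d where "d = \<bar>c\<bar> + 1"
  have d: "d > 0" "c < d" by (auto simp: d_def)
  have "b * (- b / d) + c * (- b / d)\<^sup>2 = (b / d)\<^sup>2 * (c - d)"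
    using d(1) by (simp add: field_simps power2_eq_square)
  also have "\<dots> < 0" using \<open>b \<noteq> 0\<close> d by (intro mult_pos_neg) auto
  finally show False using assms[of "- b / d"] by simp
qed

text \<open>Passes from a sum over receivers to a sum over the covariances that they see, in order
  to collect the coefficient of each covariance.\<close>

lemma sum_triangle_swap:
  fixes f :: "nat \<Rightarrow> nat \<Rightarrow> 'a::comm_monoid_add"
  shows "(\<Sum>l\<in>{1..L}. \<Sum>t\<in>{1..<l}. f l t) = (\<Sum>t\<in>{1..L}. \<Sum>l\<in>{t+1..L}. f l t)"
proof -
  have "(\<Sum>l\<in>{1..L}. \<Sum>t\<in>{1..<l}. f l t) = (\<Sum>l\<in>{1..L}. \<Sum>t | t \<in> {1..L} \<and> t < l. f l t)"
    by (intro sum.cong refl) auto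
  also have "\<dots> = (\<Sum>t\<in>{1..L}. \<Sum>l | l \<in> {1..L} \<and> t < l. f l t)"
    by (rule sum.swap_restrict) auto
  also have "\<dots> = (\<Sum>t\<in>{1..L}. \<Sum>l\<in>{t+1..L}. f l t)"
    by (intro sum.cong refl) auto
  finally show ?thesis .
qed

text \<open>With \<open>B\<close> = T and \<open>A\<close> equal to 0, the identity or
  \<open>F l\<close>, the right-hand side is G1, G2 or G3.\<close>

lemma congruence_diff_expand:
  "hadj (A - B) ** S ** (A - B) = hadj A ** S ** A - hadj B ** S ** A + hadj B ** S ** B - hadj A ** S ** B"
  for A B S :: "complex^'n^'n"
  by (simp add: hadj_diff mm.diff_left mm.diff_right)

text \<open>Perturbing \<open>F l\<close> alone keeps the design feasible and makes the expected gap
  an exact quadratic polynomial in the step \<open>e\<close>. It must not be negative after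
  weighting, so its linear coefficient vanishes.\<close>

lemma optimal_design_F_stationary:
  fixes P F :: "nat \<Rightarrow> complex^'t^'t" and H :: "nat \<Rightarrow> 'w \<Rightarrow> complex^'t^'r"
  assumes M: "prob_space M" and N0: "N0 > 0" and \<mu>: "\<forall>l\<in>{1..L}. \<mu> l \<ge> 0"
    and H: "\<forall>l\<in>{1..L}. H l \<in> borel_measurable M"
      "\<forall>l\<in>{1..L}. (\<integral>\<^sup>+\<omega>. ennreal (Re (trace (H l \<omega> ** hadj (H l \<omega>)))) \<partial>M) < \<infinity>"
    and opt: "optimal_design M H L N0 Pw \<mu> F P" and l: "l \<in> {1..L}"
  shows "\<mu> l *\<^sub>R (\<integral>\<omega>. matrix_inv (SigUY L N0 F (SigOf P) l (H l \<omega>))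
    ** (F l - Tmat L N0 F (SigOf P) l (H l \<omega>)) ** SigS (SigOf P) l \<partial>M) = 0"
proof -
  let ?S = "\<lambda>H. matrix_inv (SigUY L N0 F (SigOf P) l H)"
  let ?V = "\<lambda>H. F l - Tmat L N0 F (SigOf P) l H"
  let ?SS = "SigS (SigOf P) l"
  \<comment> \<open>The direction of perturbation is the expectation itself, so the linear
    coefficient is a multiple of its squared norm.\<close>
  define J where "J = (\<integral>\<omega>. ?S (H l \<omega>) ** ?V (H l \<omega>) ** ?SS \<partial>M)"
  define q where "q = (\<integral>\<omega>. (hadj J ** ?S (H l \<omega>) ** J) \<bullet> ?SS \<partial>M)"
  have feas: "feasible L Pw P" using opt by (simp add: optimal_design_def)
  then have inv: "invertible (P l)" using l by (simp add: feasible_def)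
  have hSS: "hadj ?SS = ?SS" by (rule hermitian_SigOf)
  note int = prob_space.integrable_quad_cont[OF M _ H(1)[rule_format, OF l] H(2)[rule_format, OF l]]
  have int1: "integrable M (\<lambda>\<omega>. ?S (H l \<omega>) ** ?V (H l \<omega>) ** ?SS)"
    by (rule int, intro quad_cont_mult_right quad_cont_inv_SigUY bdd_cont_diff bdd_cont_const
        bdd_cont_Tmat N0 inv)
  have int2: "integrable M (\<lambda>\<omega>. (hadj J ** ?S (H l \<omega>) ** J) \<bullet> ?SS)"
    by (rule int[where f = "\<lambda>H. (hadj J ** ?S H ** J) \<bullet> ?SS"],
        intro quad_cont_inner quad_cont_congruence bdd_cont_const N0 inv)
  define F' where "F' e = F(l := F l + e *\<^sub>R J)" for e
  have F'_l: "F' e l = F l + e *\<^sub>R J" and F'_neq: "k \<noteq> l \<Longrightarrow> F' e k = F k" for e k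
    by (simp_all add: F'_def)
  have gap: "mse_gap L N0 F P (F' e) P l h
      = 2 * e * ((?S h ** ?V h ** ?SS) \<bullet> J) + e\<^sup>2 * ((hadj J ** ?S h ** J) \<bullet> ?SS)" for e h
  proof -
    have hS: "hadj (?S h) = ?S h" by (intro hermitian_matrix_inv_pd pd_SigUY N0 inv)
    have V: "F l + e *\<^sub>R J - Tmat L N0 F (SigOf P) l h = ?V h + e *\<^sub>R J" by simp
    \<comment> \<open>Both cross terms of the expansion reduce to the same inner product, as
      \<open>?S h\<close> and \<open>?SS\<close> are Hermitian.\<close>
    have 1: "(hadj (?V h) ** ?S h ** J) \<bullet> ?SS = (?S h ** ?V h ** ?SS) \<bullet> J"
    proof -
      have "(hadj (?V h) ** (?S h ** J)) \<bullet> ?SS = J \<bullet> (?S h ** (?V h ** ?SS))"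
        unfolding matrix_inner_mult_left by (simp add: hS)
      then show ?thesis by (simp add: matrix_mul_assoc inner_commute)
    qed
    have 2: "(hadj J ** ?S h ** ?V h) \<bullet> ?SS = (?S h ** ?V h ** ?SS) \<bullet> J"
    proof -
      have "(hadj J ** (?S h ** ?V h)) \<bullet> ?SS = (?S h ** ?V h) \<bullet> (J ** ?SS)"
        unfolding matrix_inner_mult_left[of "hadj J"] by simp
      also have "\<dots> = ((?S h ** ?V h) ** ?SS) \<bullet> J"
        unfolding matrix_inner_mult_right[of "?S h ** ?V h"] hSS ..
      finally show ?thesis by (simp add: matrix_mul_assoc)
    qed
    have "mse_gap L N0 F P (F' e) P l h
        = (hadj (?V h + e *\<^sub>R J) ** ?S h ** (?V h + e *\<^sub>R J)) \<bullet> ?SS - (hadj (?V h) ** ?S h ** ?V h) \<bullet> ?SS"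
      unfolding mse_gap_def Let_def F'_l V by simp
    also have "hadj (?V h + e *\<^sub>R J) ** ?S h ** (?V h + e *\<^sub>R J)
        = hadj (?V h) ** ?S h ** ?V h + e *\<^sub>R (hadj (?V h) ** ?S h ** J)
          + e *\<^sub>R (hadj J ** ?S h ** ?V h) + e\<^sup>2 *\<^sub>R (hadj J ** ?S h ** J)"
      by (simp only: hadj_add hadj_scaleR mm.add_left mm.add_right mm.scaleR_left mm.scaleR_right
          scaleR_scaleR power2_eq_square scaleR_add_right add.assoc) (simp add: algebra_simps)
    finally show ?thesis by (simp add: inner_add_left 1 2)
  qed
  have "0 \<le> 2 * \<mu> l * (J \<bullet> J) * e + \<mu> l * q * e\<^sup>2" for e
  proof -
    let ?F' = "F' e"
    have "mse_gap L N0 F P ?F' P k h = 0" if "k \<noteq> l" for k and h :: "complex^'t^'r"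
      using that by (simp add: mse_gap_def Let_def F'_neq)
    then have "(\<Sum>k\<in>{1..L}. \<mu> k * (ln (Re (det (SigOf P k))) - ln (Re (det (SigOf P k)))
        - (\<integral>\<omega>. mse_gap L N0 F P ?F' P k (H k \<omega>) \<partial>M)))
      = (\<Sum>k\<in>{1..L}. if k = l then - (\<mu> l * (\<integral>\<omega>. mse_gap L N0 F P ?F' P l (H l \<omega>) \<partial>M)) else 0)"
      by (intro sum.cong refl) auto
    also have "\<dots> = - (\<mu> l * (\<integral>\<omega>. mse_gap L N0 F P ?F' P l (H l \<omega>) \<partial>M))"
      using l by simp
    finally have "0 \<le> \<mu> l * (\<integral>\<omega>. mse_gap L N0 F P ?F' P l (H l \<omega>) \<partial>M)"
      using optimal_design_surrogate[OF M N0 \<mu> H opt feas, of ?F'] by linarith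
    also have "(\<integral>\<omega>. mse_gap L N0 F P ?F' P l (H l \<omega>) \<partial>M) = 2 * e * (J \<bullet> J) + e\<^sup>2 * q"
      unfolding gap using int1 int2 by (simp add: J_def q_def)
    finally show ?thesis by (simp add: algebra_simps)
  qed
  then have "2 * \<mu> l * (J \<bullet> J) = 0" by (rule linear_coefficient_zero)
  \<comment> \<open>Either the weight or \<open>J\<close> is zero, which is why the weight stays in
    the conclusion.\<close>
  then show ?thesis by (auto simp: J_def)
qed

text \<open>One formula for the expectations of G1, G2 and G3, obtained for \<open>V\<close> equal
  to 0, the identity and \<open>F l\<close>.\<close>

definition mean_gram :: "'w measure \<Rightarrow> (nat \<Rightarrow> 'w \<Rightarrow> complex^'t^'r) \<Rightarrow> nat \<Rightarrow> real \<Rightarrow>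
    (nat \<Rightarrow> complex^'t^'t) \<Rightarrow> (nat \<Rightarrow> complex^'t^'t) \<Rightarrow> complex^'t^'t \<Rightarrow> nat \<Rightarrow> complex^'t^'t" where
  "mean_gram M H L N0 F P V l = (\<integral>\<omega>. hadj (V - Tmat L N0 F (SigOf P) l (H l \<omega>))
      ** matrix_inv (SigUY L N0 F (SigOf P) l (H l \<omega>)) ** (V - Tmat L N0 F (SigOf P) l (H l \<omega>)) \<partial>M)"

text \<open>With \<open>F\<close> kept fixed the gap is affine in the covariances of P'. Collecting
  coefficients shows that \<open>P\<close> maximises log-determinants minus a quadratic form, so
  \<open>log_det_power_KKT\<close> applies.\<close>

lemma optimal_design_P_stationary:
  fixes P F :: "nat \<Rightarrow> complex^'t^'t" and H :: "nat \<Rightarrow> 'w \<Rightarrow> complex^'t^'r"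
  assumes M: "prob_space M" and N0: "N0 > 0" and L: "L \<ge> 1" and \<mu>: "\<forall>l\<in>{1..L}. \<mu> l \<ge> 0"
    and H: "\<forall>l\<in>{1..L}. H l \<in> borel_measurable M"
      "\<forall>l\<in>{1..L}. (\<integral>\<^sup>+\<omega>. ennreal (Re (trace (H l \<omega> ** hadj (H l \<omega>)))) \<partial>M) < \<infinity>"
    and opt: "optimal_design M H L N0 Pw \<mu> F P"
  defines "C \<equiv> mean_gram M H L N0 F P"
  shows "\<exists>\<theta>\<ge>0. (\<forall>t\<in>{1..L}. \<mu> t *\<^sub>R matrix_inv (hadj (P t))
      - ((\<Sum>l\<in>{1..<t}. \<mu> l *\<^sub>R C 0 l) + \<mu> t *\<^sub>R C (mat 1) t + (\<Sum>l\<in>{t+1..L}. \<mu> l *\<^sub>R C (F l) l)) ** P t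
      = \<theta> *\<^sub>R P t)
    \<and> \<theta> * ((\<Sum>l\<in>{1..L}. (norm (P l))\<^sup>2) - Pw) = 0"
proof -
  \<comment> \<open>Coefficient of the covariance of stream \<open>t\<close>: it is noise for
    receivers \<open>l < t\<close>, the wanted signal for receiver \<open>t\<close>, and
    interference known to the encoder and weighted by \<open>F l\<close> for receivers
    \<open>l > t\<close>.\<close>
  define K where "K t = (\<Sum>l\<in>{1..<t}. \<mu> l *\<^sub>R C 0 l) + \<mu> t *\<^sub>R C (mat 1) t
    + (\<Sum>l\<in>{t+1..L}. \<mu> l *\<^sub>R C (F l) l)" for t
  let ?S = "\<lambda>l H. matrix_inv (SigUY L N0 F (SigOf P) l H)"
  let ?T = "\<lambda>l H. Tmat L N0 F (SigOf P) l H"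
  have feas: "feasible L Pw P" using opt by (simp add: optimal_design_def)
  then have inv: "invertible (P l)" if "l \<in> {1..L}" for l using that by (simp add: feasible_def)
  define E where "E V l h = hadj (V - ?T l h) ** ?S l h ** (V - ?T l h)" for V l and h :: "complex^'t^'r"
  have C_eq: "C V l = (\<integral>\<omega>. E V l (H l \<omega>) \<partial>M)" for V l
    by (simp add: C_def mean_gram_def E_def)
  have int: "integrable M (\<lambda>\<omega>. E V l (H l \<omega>))" if l: "l \<in> {1..L}" for V l
    unfolding E_def
    by (rule prob_space.integrable_quad_cont[OF M _ H(1)[rule_format, OF l] H(2)[rule_format, OF l]],
        intro quad_cont_congruence bdd_cont_diff bdd_cont_const bdd_cont_Tmat N0 inv l)
  have herm_C: "hadj (C V l) = C V l" if l: "l \<in> {1..L}" for V l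
  proof -
    have "hadj (?S l h) = ?S l h" for h :: "complex^'t^'r"
      by (intro hermitian_matrix_inv_pd pd_SigUY N0 inv l)
    then show ?thesis
      \<comment> \<open>The adjoint is bounded and linear, so it commutes with the
        expectation.\<close>
      unfolding C_eq integral_bounded_linear[OF bounded_linear_hadj int[OF l], symmetric]
      by (simp add: E_def hadj_mult matrix_mul_assoc)
  qed
  have herm: "hadj (K t) = K t" if "t \<in> {1..L}" for t
    using that herm_C by (simp add: K_def hadj_add hadj_sum hadj_scaleR)
  have gap: "(\<integral>\<omega>. mse_gap L N0 F P F P' l (H l \<omega>) \<partial>M)
      = C (F l) l \<bullet> (\<Sum>t\<in>{1..<l}. SigOf P' t - SigOf P t) + C (mat 1) l \<bullet> (SigOf P' l - SigOf P l)
        + C 0 l \<bullet> (\<Sum>t\<in>{l+1..L}. SigOf P' t - SigOf P t)" if l: "l \<in> {1..L}" for P' l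
  proof -
    have "mse_gap L N0 F P F P' l h
      = E (F l) l h \<bullet> (\<Sum>t\<in>{1..<l}. SigOf P' t - SigOf P t)
      + E (mat 1) l h \<bullet> (SigOf P' l - SigOf P l)
      + E 0 l h \<bullet> (\<Sum>t\<in>{l+1..L}. SigOf P' t - SigOf P t)"
      for h :: "complex^'t^'r"
      unfolding mse_gap_def E_def Let_def SigS_def SigN_def sum_subtractf congruence_diff_expand[of 0]
      by (simp add: inner_diff_right mm.zero_left mm.zero_right)
    then show ?thesis unfolding C_eq using int[OF l] by simp
  qed
  have "\<exists>\<theta>\<ge>0. (\<forall>t\<in>{1..L}. \<mu> t *\<^sub>R matrix_inv (hadj (P t)) - K t ** P t = \<theta> *\<^sub>R P t)
    \<and> \<theta> * ((\<Sum>l\<in>{1..L}. (norm (P l))\<^sup>2) - Pw) = 0"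
  proof (rule log_det_power_KKT)
    show "finite {1..L}" "{1..L} \<noteq> {}" using L by auto
    show "(\<Sum>l\<in>{1..L}. (norm (P l))\<^sup>2) \<le> Pw"
      using feas by (simp add: feasible_def Re_trace_gram)
    fix P' :: "nat \<Rightarrow> complex^'t^'t"
    assume "\<And>t. t \<in> {1..L} \<Longrightarrow> invertible (P' t)" "(\<Sum>l\<in>{1..L}. (norm (P' l))\<^sup>2) \<le> Pw"
    then have feas': "feasible L Pw P'" by (simp add: feasible_def Re_trace_gram)
    let ?d = "\<lambda>l. ln (Re (det (SigOf P' l))) - ln (Re (det (SigOf P l)))"
    let ?D = "\<lambda>t. SigOf P' t - SigOf P t"
    have "(\<Sum>l\<in>{1..L}. \<mu> l * (\<integral>\<omega>. mse_gap L N0 F P F P' l (H l \<omega>) \<partial>M))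
      = (\<Sum>l\<in>{1..L}. \<Sum>t\<in>{1..<l}. \<mu> l * (C (F l) l \<bullet> ?D t))
        + (\<Sum>l\<in>{1..L}. \<mu> l * (C (mat 1) l \<bullet> ?D l))
        + (\<Sum>l\<in>{1..L}. \<Sum>t\<in>{l+1..L}. \<mu> l * (C 0 l \<bullet> ?D t))"
      by (simp only: gap inner_sum_right distrib_left sum_distrib_left sum.distrib cong: sum.cong)
    also have "(\<Sum>l\<in>{1..L}. \<Sum>t\<in>{1..<l}. \<mu> l * (C (F l) l \<bullet> ?D t))
        = (\<Sum>t\<in>{1..L}. \<Sum>l\<in>{t+1..L}. \<mu> l * (C (F l) l \<bullet> ?D t))"
      by (rule sum_triangle_swap)
    also have "(\<Sum>l\<in>{1..L}. \<Sum>t\<in>{l+1..L}. \<mu> l * (C 0 l \<bullet> ?D t))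
        = (\<Sum>t\<in>{1..L}. \<Sum>l\<in>{1..<t}. \<mu> l * (C 0 l \<bullet> ?D t))"
      by (rule sum_triangle_swap[symmetric])
    also have "(\<Sum>t\<in>{1..L}. \<Sum>l\<in>{t+1..L}. \<mu> l * (C (F l) l \<bullet> ?D t))
        + (\<Sum>l\<in>{1..L}. \<mu> l * (C (mat 1) l \<bullet> ?D l))
        + (\<Sum>t\<in>{1..L}. \<Sum>l\<in>{1..<t}. \<mu> l * (C 0 l \<bullet> ?D t))
        = (\<Sum>t\<in>{1..L}. K t \<bullet> ?D t)"
      unfolding K_def inner_add_left inner_sum_left inner_scaleR_left sum.distrib by simp
    finally have "(\<Sum>l\<in>{1..L}. \<mu> l * ?d l) - (\<Sum>t\<in>{1..L}. K t \<bullet> ?D t) \<le> 0"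
      using optimal_design_surrogate[OF M N0 \<mu> H opt feas', of F]
      unfolding right_diff_distrib[of _ "?d _"] sum_subtractf by simp
    then have "(\<Sum>t\<in>{1..L}. \<mu> t * ln (Re (det (SigOf P' t))) - K t \<bullet> SigOf P' t)
      \<le> (\<Sum>t\<in>{1..L}. \<mu> t * ln (Re (det (SigOf P t))) - K t \<bullet> SigOf P t)"
      by (simp add: right_diff_distrib inner_diff_right sum_subtractf)
    then show "(\<Sum>t\<in>{1..L}. \<mu> t * ln (Re (det (P' t ** hadj (P' t)))) - (K t ** P' t) \<bullet> P' t)
      \<le> (\<Sum>t\<in>{1..L}. \<mu> t * ln (Re (det (P t ** hadj (P t)))) - (K t ** P t) \<bullet> P t)"
      by (simp add: SigOf_def matrix_inner_mult_right)
  qed (use inv herm in auto)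
  then show ?thesis unfolding K_def .
qed

theorem theorem1:
  fixes M :: "'w measure"
    and H :: "nat \<Rightarrow> 'w \<Rightarrow> complex^'nt^'nr"
    and L :: nat and N0 Pw :: real and \<mu> :: "nat \<Rightarrow> real"
    and F P :: "nat \<Rightarrow> complex^'nt^'nt"
  assumes "prob_space M"
    and "L \<ge> 1" and "N0 > 0" and "Pw > 0"
    and "\<forall>l\<in>{1..L}. \<mu> l \<ge> 0" and "(\<Sum>l\<in>{1..L}. \<mu> l) = real L"
    and "\<forall>l\<in>{1..L}. H l \<in> borel_measurable M"
    and "prob_space.indep_vars M (\<lambda>_. borel) H {1..L}"
    and "\<forall>l\<in>{1..L}. (\<integral>\<^sup>+\<omega>. ennreal (Re (trace (H l \<omega> ** hadj (H l \<omega>)))) \<partial>M) < \<infinity>"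
    and "optimal_design M H L N0 Pw \<mu> F P"
  shows "\<exists>\<theta>::real.
    (\<forall>l\<in>{1..L}.
       (- (\<mu> l * log 2 (exp 1))) *\<^sub>R
         (\<integral>\<omega>. matrix_inv (SigUY L N0 F (SigOf P) l (H l \<omega>))
                 ** (F l - Tmat L N0 F (SigOf P) l (H l \<omega>)) ** SigS (SigOf P) l \<partial>M) = 0)
  \<and> (\<forall>l\<in>{1..L}. SigOf P l = P l ** hadj (P l))
  \<and> (\<forall>t\<in>{1..L}.
       let S = (\<lambda>l \<omega>. matrix_inv (SigUY L N0 F (SigOf P) l (H l \<omega>)));
           T = (\<lambda>l \<omega>. Tmat L N0 F (SigOf P) l (H l \<omega>));
           G1 = (\<lambda>l \<omega>. hadj (T l \<omega>) ** S l \<omega> ** T l \<omega>);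
           G2 = (\<lambda>l \<omega>. S l \<omega> - hadj (T l \<omega>) ** S l \<omega> + hadj (T l \<omega>) ** S l \<omega> ** T l \<omega>
                        - S l \<omega> ** T l \<omega>);
           G3 = (\<lambda>l \<omega>. hadj (F l) ** S l \<omega> ** F l - hadj (T l \<omega>) ** S l \<omega> ** F l
                        + hadj (T l \<omega>) ** S l \<omega> ** T l \<omega> - hadj (F l) ** S l \<omega> ** T l \<omega>)
       in (\<mu> t * log 2 (exp 1)) *\<^sub>R matrix_inv (hadj (P t))
          - log 2 (exp 1) *\<^sub>R
              ((\<Sum>l\<in>{1..<t}. \<mu> l *\<^sub>R (\<integral>\<omega>. G1 l \<omega> \<partial>M))
               + \<mu> t *\<^sub>R (\<integral>\<omega>. G2 t \<omega> \<partial>M)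
               + (\<Sum>l\<in>{t+1..L}. \<mu> l *\<^sub>R (\<integral>\<omega>. G3 l \<omega> \<partial>M))) ** P t
          = \<theta> *\<^sub>R P t)
  \<and> \<theta> * ((\<Sum>l\<in>{1..L}. Re (trace (P l ** hadj (P l)))) - Pw) = 0
  \<and> (\<Sum>l\<in>{1..L}. Re (trace (P l ** hadj (P l)))) - Pw \<le> 0
  \<and> \<theta> \<ge> 0"
proof -
  \<comment> \<open>The surrogate uses natural logarithms; \<open>c\<close> = log_2 e converts to
    the base of the rates and scales the multiplier accordingly.\<close>
  define c where "c = log 2 (exp 1)"
  have c: "c \<ge> 0" by (simp add: c_def log_def)
  note [simp] = c_def[symmetric]
  obtain \<theta> where \<theta>: "\<theta> \<ge> 0"
    and eq: "\<theta> * ((\<Sum>l\<in>{1..L}. (norm (P l))\<^sup>2) - Pw) = 0"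
    and stat: "\<forall>t\<in>{1..L}. \<mu> t *\<^sub>R matrix_inv (hadj (P t))
      - ((\<Sum>l\<in>{1..<t}. \<mu> l *\<^sub>R mean_gram M H L N0 F P 0 l)
        + \<mu> t *\<^sub>R mean_gram M H L N0 F P (mat 1) t
        + (\<Sum>l\<in>{t+1..L}. \<mu> l *\<^sub>R mean_gram M H L N0 F P (F l) l)) ** P t
      = \<theta> *\<^sub>R P t"
    using optimal_design_P_stationary[OF assms(1,3,2,5,7,9,10)] by blast
  have feas: "feasible L Pw P" using assms(10) by (simp add: optimal_design_def)
  show ?thesis
  proof (intro exI[of _ "c * \<theta>"] conjI)
    show "\<forall>l\<in>{1..L}. (- (\<mu> l * log 2 (exp 1))) *\<^sub>R
         (\<integral>\<omega>. matrix_inv (SigUY L N0 F (SigOf P) l (H l \<omega>))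
                 ** (F l - Tmat L N0 F (SigOf P) l (H l \<omega>)) ** SigS (SigOf P) l \<partial>M) = 0"
      using optimal_design_F_stationary[OF assms(1,3,5,7,9,10)] by auto
    show "\<forall>l\<in>{1..L}. SigOf P l = P l ** hadj (P l)" by (simp add: SigOf_def)
    show "c * \<theta> * ((\<Sum>l\<in>{1..L}. Re (trace (P l ** hadj (P l)))) - Pw) = 0"
      using eq by (simp add: Re_trace_gram)
    show "(\<Sum>l\<in>{1..L}. Re (trace (P l ** hadj (P l)))) - Pw \<le> 0"
      using feas by (simp add: feasible_def)
    show "c * \<theta> \<ge> 0" using c \<theta> by simp
  next
    have scale: "(m * c) *\<^sub>R A - (c *\<^sub>R B) ** X = (c * \<theta>) *\<^sub>R X"
      if "m *\<^sub>R A - B ** X = \<theta> *\<^sub>R X" for m and A B X :: "complex^'nt^'nt"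
    proof -
      have "c *\<^sub>R (m *\<^sub>R A - B ** X) = c *\<^sub>R \<theta> *\<^sub>R X" using that by simp
      then show ?thesis by (simp add: mm.scaleR_left scaleR_diff_right mult.commute)
    qed
    show "\<forall>t\<in>{1..L}. let S = (\<lambda>l \<omega>. matrix_inv (SigUY L N0 F (SigOf P) l (H l \<omega>)));
           T = (\<lambda>l \<omega>. Tmat L N0 F (SigOf P) l (H l \<omega>));
           G1 = (\<lambda>l \<omega>. hadj (T l \<omega>) ** S l \<omega> ** T l \<omega>);
           G2 = (\<lambda>l \<omega>. S l \<omega> - hadj (T l \<omega>) ** S l \<omega> + hadj (T l \<omega>) ** S l \<omega> ** T l \<omega>
                        - S l \<omega> ** T l \<omega>);
           G3 = (\<lambda>l \<omega>. hadj (F l) ** S l \<omega> ** F l - hadj (T l \<omega>) ** S l \<omega> ** F l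
                        + hadj (T l \<omega>) ** S l \<omega> ** T l \<omega> - hadj (F l) ** S l \<omega> ** T l \<omega>)
       in (\<mu> t * log 2 (exp 1)) *\<^sub>R matrix_inv (hadj (P t))
          - log 2 (exp 1) *\<^sub>R
              ((\<Sum>l\<in>{1..<t}. \<mu> l *\<^sub>R (\<integral>\<omega>. G1 l \<omega> \<partial>M))
               + \<mu> t *\<^sub>R (\<integral>\<omega>. G2 t \<omega> \<partial>M)
               + (\<Sum>l\<in>{t+1..L}. \<mu> l *\<^sub>R (\<integral>\<omega>. G3 l \<omega> \<partial>M))) ** P t
          = (c * \<theta>) *\<^sub>R P t"
      unfolding Let_def c_def[symmetric]
      using stat unfolding mean_gram_def congruence_diff_expand
      by (intro ballI scale) simp
  qed
qed

end
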